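(* Let $\alpha>0$ and let $\mu$ be a probability measure on $[0,\infty)$ with $\mu((0,\infty))>0$. Suppose that $$\rho := \liminf_{x\to\infty} -\frac{\ln \mu([x,\infty))}{x}\ge \alpha .$$ Then, as $t\to\infty$, $$P_\mu (X_t \in \cdot \mid \tau> t) \to \pi_0$$ in distribution, where $\pi_0$ is the probability measure on $(0,\infty)$ with density $\alpha^2 x e^{-\alpha x}$.
   Context: $X=(X_t:t\ge 0)$ is Brownian motion with constant negative drift $-\alpha$ ($\alpha>0$) on $[0,\infty)$, absorbed at $0$; that is, $X_t=X_0+B_t-\alpha t$ up to the hitting time $\tau=\inf\{t\ge 0: X_t=0\}$, with $B$ a standard Brownian motion started at $0$ and independent of $X_0$, and $X_t=0$ for $t\ge\tau$. $P_\mu$ denotes the law of the process when $X_0$ has distribution $\mu$. The convention $\ln 0=-\infty$ is used, so $-\ln\mu([x,\infty))/x=+\infty$ when $\mu([x,\infty))=0$. *)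

theory Defs
  imports "HOL-Probability.Probability"
begin

locale standard_brownian_motion = prob_space M
  for M :: "'a measure" and B :: "real \<Rightarrow> 'a \<Rightarrow> real" +
  assumes random_variable: "0 \<le> t \<Longrightarrow> B t \<in> borel_measurable M"
    and start_zero: "\<omega> \<in> space M \<Longrightarrow> B 0 \<omega> = 0"
    and continuous_paths: "\<omega> \<in> space M \<Longrightarrow> continuous_on {0..} (\<lambda>t. B t \<omega>)"
    and normal_increments: "0 \<le> s \<Longrightarrow> s < t \<Longrightarrow>
      distributed M lborel (\<lambda>\<omega>. B t \<omega> - B s \<omega>)
        (\<lambda>x. ennreal (normal_density 0 (sqrt (t - s)) x))"
    and indep_increments: "\<And>(n::nat) (u::nat \<Rightarrow> real).
      0 \<le> u 0 \<Longrightarrow> (\<And>i. i < n \<Longrightarrow> u i < u (Suc i)) \<Longrightarrow>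
      indep_vars (\<lambda>_. borel) (\<lambda>i \<omega>. B (u (Suc i)) \<omega> - B (u i) \<omega>) {..<n}"

text \<open>First zero of a path on \<open>[0, \<infinity>)\<close>; it is \<open>\<infinity>\<close> if there is none.\<close>

definition hitting_time_zero :: "(real \<Rightarrow> real) \<Rightarrow> ereal" where
  "hitting_time_zero x = Inf {ereal t | t. 0 \<le> t \<and> x t = 0}"

text \<open>
  The hitting time is that of \<open>X\<close> itself. The equation in \<open>before_absorption\<close> is
  required at the hitting time too, so the drifted path is at \<open>0\<close> when \<open>X\<close> is absorbed;
  together with \<open>after_absorption\<close> it determines \<open>X t\<close> for all \<open>t \<ge> 0\<close>
  from \<open>X 0\<close> and \<open>B\<close>.
\<close>

locale absorbed_drifted_brownian_motion = standard_brownian_motion M B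
  for M :: "'a measure" and B :: "real \<Rightarrow> 'a \<Rightarrow> real" +
  fixes \<alpha> :: real and X :: "real \<Rightarrow> 'a \<Rightarrow> real"
  assumes initial_random_variable: "X 0 \<in> borel_measurable M"
    and initial_nonneg: "\<omega> \<in> space M \<Longrightarrow> 0 \<le> X 0 \<omega>"
    and initial_indep: "indep_set
      (sets (vimage_algebra (space M) (X 0) borel))
      (sets (vimage_algebra (space M) (\<lambda>\<omega>. \<lambda>t\<in>{0..}. B t \<omega>)
        (\<Pi>\<^sub>M t\<in>{0..}. (borel :: real measure))))"
    and before_absorption: "\<omega> \<in> space M \<Longrightarrow> 0 \<le> t \<Longrightarrow>
      ereal t \<le> hitting_time_zero (\<lambda>s. X s \<omega>) \<Longrightarrow> X t \<omega> = X 0 \<omega> + B t \<omega> - \<alpha> * t"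
    and after_absorption: "\<omega> \<in> space M \<Longrightarrow> 0 \<le> t \<Longrightarrow>
      hitting_time_zero (\<lambda>s. X s \<omega>) \<le> ereal t \<Longrightarrow> X t \<omega> = 0"

definition survival_event :: "'a measure \<Rightarrow> (real \<Rightarrow> 'a \<Rightarrow> real) \<Rightarrow> real \<Rightarrow> 'a set" where
  "survival_event M X t = {\<omega> \<in> space M. ereal t < hitting_time_zero (\<lambda>s. X s \<omega>)}"

definition conditional_law :: "'a measure \<Rightarrow> (real \<Rightarrow> 'a \<Rightarrow> real) \<Rightarrow> real \<Rightarrow> real measure" where
  "conditional_law M X t = distr (uniform_measure M (survival_event M X t)) borel (X t)"

text \<open>The logarithm of a number \<open>p \<ge> 0\<close>, with \<open>ln 0 = -\<infinity>\<close>.\<close>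

definition ln_ext :: "real \<Rightarrow> ereal" where
  "ln_ext p = (if p = 0 then - \<infinity> else ereal (ln p))"

definition tail_rate :: "real measure \<Rightarrow> ereal" where
  "tail_rate \<mu> = Liminf at_top (\<lambda>x::real. (- ln_ext (measure \<mu> {x..})) / ereal x)"

definition limit_law :: "real \<Rightarrow> real measure" where
  "limit_law \<alpha> = density lborel
    (\<lambda>x. ennreal (\<alpha>\<^sup>2 * x * exp (- \<alpha> * x)) * indicator {0<..} x)"

text \<open>The library's \<^const>\<open>weak_conv_m\<close> is for sequences of measures only.\<close>

definition weak_conv_filter :: "('i \<Rightarrow> real measure) \<Rightarrow> real measure \<Rightarrow> 'i filter \<Rightarrow> bool" where
  "weak_conv_filter N L F \<longleftrightarrow>
    (\<forall>x. isCont (cdf L) x \<longrightarrow> ((\<lambda>i. cdf (N i) x) \<longlongrightarrow> cdf L x) F)"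

lemma weak_conv_filter_sequentially: "weak_conv_filter N L sequentially \<longleftrightarrow> weak_conv_m N L"
  by (simp add: weak_conv_filter_def weak_conv_m_def weak_conv_def)

end

theory Submission
  imports Defs
begin

text \<open>
  Write \<open>Y s = x + B s - \<alpha> * s\<close> for the drifted path without absorption. Everything rests on an explicit
  formula for \<open>P(X t > y, \<tau> > t)\<close> when the process starts at \<open>x\<close>, and on the shape of its dependence on \<open>x\<close>.

  The formula comes from the reflection principle, in a form that uses neither the strong Markov property nor
  Girsanov's theorem for paths. A bounded function \<open>k\<close> on \<open>(0, \<infinity>)\<close> is extended to the line by
  \<open>F z = k z - exp (2 * \<alpha> * z) * k (- z)\<close>. This extension is antisymmetric with respect to the law of the drifted
  motion started at \<open>0\<close>, so \<open>E F(B s - \<alpha> * s) = 0\<close> for all \<open>s\<close>; if \<open>F\<close> is moreover Lipschitz, then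
  \<open>E F(z + B s - \<alpha> * s)\<close> is \<open>O(\<bar>z\<bar>)\<close> uniformly in \<open>s\<close>. Stop \<open>Y\<close> at the first point of a dyadic grid at which it is
  at most \<open>\<delta>\<close>. It is then within \<open>\<delta>\<close> plus a vanishing overshoot of \<open>0\<close>, and independence of the later increment
  makes \<open>E[F(Y t); stopped before t]\<close> small. In the limit \<open>E[F(Y t); \<tau> \<le> t] = 0\<close> (\<open>hitting_part_vanishes\<close>),
  that is, \<open>E[k(X t); \<tau> > t] = E F(Y t)\<close> (\<open>survival_reflection\<close>). Integrating out the independent
  starting point gives (\<open>survival_tail\<close>)
  \<open>P(X t > y, \<tau> > t) = c t * \<integral> exp (\<alpha> x - x\<^sup>2 / 2t) (\<integral>\<^bsub>z>y\<^esub> exp (- \<alpha> z - z\<^sup>2 / 2t) sinh (x z / t) dz) \<mu>(dx)\<close>,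
  where the factor \<open>c t\<close> does not depend on \<open>y\<close> and cancels in the conditional law.

  For \<open>x \<le> \<epsilon> t\<close> the ratio \<open>sinh (x z / t) / (x z / t)\<close> lies between \<open>1\<close> and \<open>exp (\<epsilon> z)\<close>. Hence on this range the inner
  integral is \<open>x / t\<close> times a quantity that, for large \<open>t\<close> and small \<open>\<epsilon>\<close>, is close to
  \<open>\<integral>\<^bsub>z>y\<^esub> z exp (- \<alpha> z) dz\<close>, and this is the tail of the limit law up to the factor \<open>\<alpha>\<^sup>2\<close>. The dependence on \<open>x\<close>
  thus separates from the dependence on \<open>y\<close>. The hypothesis on the tail of \<open>\<mu>\<close> serves to discard \<open>x > \<epsilon> t\<close>: it makes
  \<open>\<integral> exp (\<beta> x) \<mu>(dx)\<close> finite for every \<open>\<beta> < \<alpha>\<close>, and since \<open>x\<^sup>2 / 2t\<close> is at least of order \<open>\<epsilon> x\<close> there, the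
  contribution of this range is exponentially small, whereas that of \<open>x \<le> \<epsilon> t\<close> is at least of order \<open>1 / t\<close>
  because \<open>\<mu>\<close> charges \<open>(0, \<infinity>)\<close>.
\<close>

section \<open>Reflection adapted to a drift\<close>

text \<open>
  For \<open>a = 0\<close> and \<open>k\<close> supported on the positive half-line this is the odd extension used in the classical
  reflection principle. The factor \<open>exp (2 * a * z)\<close> is the density ratio of drifted Gaussian laws at \<open>- z\<close> and \<open>z\<close>.
\<close>

definition drift_odd :: "real \<Rightarrow> (real \<Rightarrow> real) \<Rightarrow> real \<Rightarrow> real" where
  "drift_odd a k z = k z - exp (2 * a * z) * k (- z)"

lemma exp_diff_le_nonpos:
  fixes u v :: real
  assumes "u \<le> v" "v \<le> 0"
  shows "exp v - exp u \<le> v - u"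
proof -
  have "exp v - exp u = exp v * (1 - exp (u - v))"
    by (simp add: algebra_simps flip: exp_add)
  also have "\<dots> \<le> 1 * (1 - exp (u - v))"
    using assms by (intro mult_right_mono) auto
  also have "\<dots> \<le> 1 * (1 - (1 + (u - v)))"
    by (intro mult_left_mono diff_left_mono exp_ge_add_one_self) simp
  also have "\<dots> = v - u" by simp
  finally show ?thesis .
qed

text \<open>
  The exponential factor is harmless because \<open>k (- z)\<close> vanishes unless \<open>z < 0\<close>: it may be replaced by
  \<open>exp (2 * a * min z 0)\<close>, which is bounded by \<open>1\<close> and is \<open>2 * a\<close>-Lipschitz.
\<close>

lemma drift_odd_lipschitz:
  fixes a m :: real
  assumes a: "0 \<le> a"
    and k: "\<And>z. 0 \<le> k z" "\<And>z. k z \<le> 1" "\<And>z. z \<le> 0 \<Longrightarrow> k z = 0"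
    and lip: "\<And>z w. \<bar>k z - k w\<bar> \<le> m * \<bar>z - w\<bar>"
  shows "\<bar>drift_odd a k z - drift_odd a k w\<bar> \<le> (2 * m + 2 * a) * \<bar>z - w\<bar>"
proof -
  define e where "e z = exp (2 * a * min z 0)" for z
  have e: "exp (2 * a * z) * k (- z) = e z * k (- z)" for z
    by (cases "z \<le> 0") (auto simp: e_def k min_def)
  have e1: "0 \<le> e z" "e z \<le> 1" for z
    using a by (auto simp: e_def mult_nonneg_nonpos)
  have elip': "\<bar>e z - e w\<bar> \<le> 2 * a * \<bar>z - w\<bar>" if "z \<le> w" for z w
  proof -
    have mm: "2 * a * min z 0 \<le> 2 * a * min w 0" "2 * a * min w 0 \<le> 0"
      using that a by (auto intro!: mult_left_mono simp: mult_nonneg_nonpos)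
    have "\<bar>e z - e w\<bar> = e w - e z" using mm by (simp add: e_def)
    also have "\<dots> \<le> 2 * a * min w 0 - 2 * a * min z 0"
      unfolding e_def using mm by (rule exp_diff_le_nonpos)
    also have "\<dots> = 2 * a * (min w 0 - min z 0)" by (simp add: algebra_simps)
    also have "\<dots> \<le> 2 * a * \<bar>z - w\<bar>"
      using that a by (intro mult_left_mono) auto
    finally show ?thesis .
  qed
  have elip: "\<bar>e z - e w\<bar> \<le> 2 * a * \<bar>z - w\<bar>" for z w
    using elip'[of z w] elip'[of w z] by (cases "z \<le> w") (auto simp: abs_minus_commute)
  have "\<bar>e z * k (- z) - e w * k (- w)\<bar> = \<bar>(e z - e w) * k (- z) + e w * (k (- z) - k (- w))\<bar>"
    by (simp add: algebra_simps)
  also have "\<dots> \<le> \<bar>e z - e w\<bar> * k (- z) + e w * \<bar>k (- z) - k (- w)\<bar>"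
    using e1[of w] k(1)[of "- z"] by (intro order.trans[OF abs_triangle_ineq]) (simp add: abs_mult)
  also have "\<dots> \<le> \<bar>e z - e w\<bar> * 1 + 1 * \<bar>k (- z) - k (- w)\<bar>"
    using e1 k by (intro add_mono mult_left_mono mult_right_mono) auto
  also have "\<dots> \<le> 2 * a * \<bar>z - w\<bar> + m * \<bar>z - w\<bar>"
    using elip[of z w] lip[of "-z" "-w"] by (simp add: abs_minus_commute)
  finally show ?thesis
    using lip[of z w] unfolding drift_odd_def e by (simp add: algebra_simps)
qed

lemma drift_odd_bounded:
  fixes a :: real
  assumes a: "0 \<le> a"
    and k: "\<And>z. 0 \<le> k z" "\<And>z. k z \<le> 1" "\<And>z. z \<le> 0 \<Longrightarrow> k z = 0"
  shows "\<bar>drift_odd a k z\<bar> \<le> 1"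
proof (cases "z \<le> 0")
  case True
  then have "exp (2 * a * z) * k (- z) \<le> 1 * 1"
    using a k by (intro mult_mono) (auto simp: mult_nonneg_nonpos)
  with True k show ?thesis by (simp add: drift_odd_def)
next
  case False
  with k show ?thesis by (simp add: drift_odd_def)
qed

lemma drift_odd_measurable [measurable]:
  assumes [measurable]: "k \<in> borel_measurable borel"
  shows "drift_odd a k \<in> borel_measurable borel"
  unfolding drift_odd_def by measurable

lemma normal_drift_tilt:
  fixes a \<sigma> z :: real
  assumes "\<sigma> > 0"
  shows "normal_density (- a * \<sigma>\<^sup>2) \<sigma> (- z) = exp (2 * a * z) * normal_density (- a * \<sigma>\<^sup>2) \<sigma> z"
proof -
  have "- (- z - - a * \<sigma>\<^sup>2)\<^sup>2 / (2 * \<sigma>\<^sup>2) = 2 * a * z + - (z - - a * \<sigma>\<^sup>2)\<^sup>2 / (2 * \<sigma>\<^sup>2)"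
    using assms by (simp add: field_simps power2_eq_square)
  then show ?thesis
    unfolding normal_density_def by (simp only: exp_add mult_ac)
qed

text \<open>
  Under \<open>z \<mapsto> - z\<close> the extension picks up the factor \<open>- exp (- 2 * a * z)\<close> and the Gaussian density of mean
  \<open>- a * \<sigma>\<^sup>2\<close> and variance \<open>\<sigma>\<^sup>2\<close> the factor \<open>exp (2 * a * z)\<close>, so the integrand is odd.
\<close>

lemma drift_odd_normal_zero:
  fixes a \<sigma> :: real
  assumes s: "\<sigma> > 0"
  shows "(\<integral>z. drift_odd a k z * normal_density (- a * \<sigma>\<^sup>2) \<sigma> z \<partial>lborel) = 0"
proof -
  let ?g = "\<lambda>z. drift_odd a k z * normal_density (- a * \<sigma>\<^sup>2) \<sigma> z"
  have "drift_odd a k (- z) = - exp (- (2 * a * z)) * drift_odd a k z" for z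
    by (simp add: drift_odd_def algebra_simps flip: exp_add)
  then have odd: "?g (- z) = - ?g z" for z
    unfolding normal_drift_tilt[OF s] by (simp flip: exp_add)
  have "integral\<^sup>L lborel ?g = (\<integral>z. ?g (- z) \<partial>lborel)"
    using lborel_integral_real_affine[of "-1" ?g 0] by simp
  also have "\<dots> = - integral\<^sup>L lborel ?g"
    unfolding odd by simp
  finally show ?thesis by simp
qed

section \<open>First passage on a grid\<close>

text \<open>
  Independence is expressed by the product form of the joint law, so that the two random elements may
  take values in different types.
\<close>

lemma (in prob_space) product_law_expectation:
  fixes V :: "'a \<Rightarrow> 'b" and W :: "'a \<Rightarrow> 'c" and f :: "'b \<Rightarrow> 'c \<Rightarrow> real"
  assumes rv [measurable]: "V \<in> measurable M S" "W \<in> measurable M T"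
    and eq: "distr M S V \<Otimes>\<^sub>M distr M T W = distr M (S \<Otimes>\<^sub>M T) (\<lambda>\<omega>. (V \<omega>, W \<omega>))"
    and f [measurable]: "(\<lambda>(v, w). f v w) \<in> borel_measurable (S \<Otimes>\<^sub>M T)"
    and f1: "\<And>v w. \<bar>f v w\<bar> \<le> C"
  shows "expectation (\<lambda>\<omega>. f (V \<omega>) (W \<omega>)) = (\<integral>v. expectation (\<lambda>\<omega>. f v (W \<omega>)) \<partial>distr M S V)"
proof -
  interpret V: prob_space "distr M S V" by (rule prob_space_distr) fact
  interpret W: prob_space "distr M T W" by (rule prob_space_distr) fact
  interpret P: pair_prob_space "distr M S V" "distr M T W" ..
  have sets: "sets (distr M S V \<Otimes>\<^sub>M distr M T W) = sets (S \<Otimes>\<^sub>M T)"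
    by (intro sets_pair_measure_cong) auto
  have int: "integrable (distr M S V \<Otimes>\<^sub>M distr M T W) (\<lambda>(v, w). f v w)"
    by (rule P.P.integrable_const_bound[where B=C])
      (use f1 f in \<open>auto simp: measurable_cong_sets[OF sets refl]\<close>)
  have "expectation (\<lambda>\<omega>. f (V \<omega>) (W \<omega>))
      = (\<integral>p. (\<lambda>(v, w). f v w) p \<partial>(distr M S V \<Otimes>\<^sub>M distr M T W))"
    unfolding eq by (subst integral_distr) auto
  also have "\<dots> = (\<integral>v. (\<integral>w. f v w \<partial>distr M T W) \<partial>distr M S V)"
    using P.integral_fst'[OF int] by simp
  also have "\<dots> = (\<integral>v. expectation (\<lambda>\<omega>. f v (W \<omega>)) \<partial>distr M S V)"
    by (intro Bochner_Integration.integral_cong refl) (subst integral_distr, auto)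
  finally show ?thesis .
qed

text \<open>
  This replaces the Markov property at a fixed time: \<open>V\<close> is the past, \<open>g V\<close> the present position, \<open>A\<close> an event
  of the past and \<open>h W\<close> the increment still to come.
\<close>

lemma (in prob_space) product_law_integral_bound:
  fixes V :: "'a \<Rightarrow> 'b" and W :: "'a \<Rightarrow> 'c" and F H :: "real \<Rightarrow> real"
  assumes rv [measurable]: "V \<in> measurable M S" "W \<in> measurable M T"
    and eq: "distr M S V \<Otimes>\<^sub>M distr M T W = distr M (S \<Otimes>\<^sub>M T) (\<lambda>\<omega>. (V \<omega>, W \<omega>))"
    and g [measurable]: "g \<in> borel_measurable S" and h [measurable]: "h \<in> borel_measurable T"
    and A [measurable]: "A \<in> sets S"
    and F [measurable]: "F \<in> borel_measurable borel" and F1: "\<And>z. \<bar>F z\<bar> \<le> 1"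
    and H [measurable]: "H \<in> borel_measurable borel" and H1: "\<And>z. \<bar>H z\<bar> \<le> 1"
    and bound: "\<And>y. \<bar>expectation (\<lambda>\<omega>. F (y + h (W \<omega>)))\<bar> \<le> H y"
  shows "\<bar>expectation (\<lambda>\<omega>. F (g (V \<omega>) + h (W \<omega>)) * indicator A (V \<omega>))\<bar>
    \<le> expectation (\<lambda>\<omega>. H (g (V \<omega>)) * indicator A (V \<omega>))"
proof -
  interpret V: prob_space "distr M S V" by (rule prob_space_distr) fact
  have E: "expectation (\<lambda>\<omega>. F (g (V \<omega>) + h (W \<omega>)) * indicator A (V \<omega>))
      = (\<integral>v. expectation (\<lambda>\<omega>. F (g v + h (W \<omega>)) * indicator A v) \<partial>distr M S V)"
    by (rule product_law_expectation[OF rv eq, where C = 1 and f = "\<lambda>v w. F (g v + h w) * indicator A v"])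
      (use F1 in \<open>auto split: split_indicator\<close>)
  have "\<bar>expectation (\<lambda>\<omega>. F (g (V \<omega>) + h (W \<omega>)) * indicator A (V \<omega>))\<bar>
      \<le> (\<integral>v. H (g v) * indicator A v \<partial>distr M S V)"
    unfolding E
  proof (rule order.trans[OF integral_abs_bound], rule integral_mono')
    show "integrable (distr M S V) (\<lambda>v. H (g v) * indicator A v)"
      by (rule V.integrable_const_bound[where B=1])
        (use H1 in \<open>auto split: split_indicator\<close>)
    fix v
    have "0 \<le> H (g v)" using bound[of "g v"] by linarith
    then show "0 \<le> H (g v) * indicator A v" by simp
    show "\<bar>expectation (\<lambda>\<omega>. F (g v + h (W \<omega>)) * indicator A v)\<bar> \<le> H (g v) * indicator A v"
      using bound[of "g v"] by (auto split: split_indicator)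
  qed
  also have "\<dots> = expectation (\<lambda>\<omega>. H (g (V \<omega>)) * indicator A (V \<omega>))"
    by (subst integral_distr) auto
  finally show ?thesis .
qed

context standard_brownian_motion
begin

lemma expectation_drift_odd_increment:
  assumes st: "0 \<le> s" "s < t"
    and k [measurable]: "k \<in> borel_measurable borel"
  shows "expectation (\<lambda>\<omega>. drift_odd a k (B t \<omega> - B s \<omega> - a * (t - s))) = 0"
proof -
  define \<sigma> where "\<sigma> = sqrt (t - s)"
  have \<sigma>: "\<sigma> > 0" "\<sigma>\<^sup>2 = t - s" using st by (auto simp: \<sigma>_def)
  let ?F = "drift_odd a k"
  have "(\<integral>z. ?F z * normal_density (- a * \<sigma>\<^sup>2) \<sigma> z \<partial>lborel)
      = (\<integral>z. ?F (- a * (t - s) + z) * normal_density (- a * \<sigma>\<^sup>2) \<sigma> (- a * (t - s) + z) \<partial>lborel)"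
    using lborel_integral_real_affine[of 1 "\<lambda>z. ?F z * normal_density (- a * \<sigma>\<^sup>2) \<sigma> z" "- a * (t - s)"]
    by simp
  also have "\<dots> = (\<integral>z. normal_density 0 \<sigma> z * ?F (z - a * (t - s)) \<partial>lborel)"
    by (simp add: normal_density_def \<sigma>(2) mult.commute)
  also have "\<dots> = expectation (\<lambda>\<omega>. ?F (B t \<omega> - B s \<omega> - a * (t - s)))"
    unfolding \<sigma>_def
    by (rule distributed_integral[OF normal_increments[OF st], where g = "\<lambda>z. ?F (z - a * (t - s))"]) auto
  finally show ?thesis using drift_odd_normal_zero[OF \<sigma>(1)] by simp
qed

text \<open>
  The expectation vanishes at \<open>y = 0\<close> by antisymmetry; the Lipschitz constant controls how much it changes
  when the starting point is moved from \<open>0\<close> to \<open>y\<close>.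
\<close>

lemma expectation_drift_odd_lipschitz:
  assumes st: "0 \<le> s" "s < t"
    and k [measurable]: "k \<in> borel_measurable borel"
    and bnd: "\<And>z. \<bar>drift_odd a k z\<bar> \<le> 1"
    and lip: "\<And>z w. \<bar>drift_odd a k z - drift_odd a k w\<bar> \<le> L * \<bar>z - w\<bar>"
  shows "\<bar>expectation (\<lambda>\<omega>. drift_odd a k (y + (B t \<omega> - B s \<omega> - a * (t - s))))\<bar> \<le> min 1 (L * \<bar>y\<bar>)"
proof -
  let ?F = "drift_odd a k" let ?Z = "\<lambda>\<omega>. B t \<omega> - B s \<omega> - a * (t - s)"
  have [measurable]: "B t \<in> borel_measurable M" "B s \<in> borel_measurable M"
    using random_variable st by auto
  have int: "integrable M (\<lambda>\<omega>. ?F (z + ?Z \<omega>))" for z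
    by (rule integrable_const_bound[where B=1]) (use bnd in auto)
  have "\<bar>expectation (\<lambda>\<omega>. ?F (y + ?Z \<omega>))\<bar>
      = \<bar>expectation (\<lambda>\<omega>. ?F (y + ?Z \<omega>) - ?F (0 + ?Z \<omega>))\<bar>"
    using expectation_drift_odd_increment[OF st k, of a]
    by (subst Bochner_Integration.integral_diff[OF int int]) simp
  also have "\<dots> \<le> expectation (\<lambda>\<omega>. \<bar>?F (y + ?Z \<omega>) - ?F (0 + ?Z \<omega>)\<bar>)"
    by (rule integral_abs_bound)
  also have "\<dots> \<le> expectation (\<lambda>\<omega>. L * \<bar>y\<bar>)"
  proof (intro integral_mono Bochner_Integration.integrable_abs Bochner_Integration.integrable_diff int)
    show "\<bar>?F (y + ?Z \<omega>) - ?F (0 + ?Z \<omega>)\<bar> \<le> L * \<bar>y\<bar>" for \<omega>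
      using lip[of "y + ?Z \<omega>" "0 + ?Z \<omega>"] by simp
  qed auto
  also have "\<dots> = L * \<bar>y\<bar>" by (simp add: prob_space)
  finally have 1: "\<bar>expectation (\<lambda>\<omega>. ?F (y + ?Z \<omega>))\<bar> \<le> L * \<bar>y\<bar>" .
  have "\<bar>expectation (\<lambda>\<omega>. ?F (y + ?Z \<omega>))\<bar> \<le> expectation (\<lambda>\<omega>. \<bar>?F (y + ?Z \<omega>)\<bar>)"
    by (rule integral_abs_bound)
  also have "\<dots> \<le> expectation (\<lambda>\<omega>. 1)"
    using bnd by (intro integral_mono Bochner_Integration.integrable_abs int) auto
  finally have 2: "\<bar>expectation (\<lambda>\<omega>. ?F (y + ?Z \<omega>))\<bar> \<le> 1" by (simp add: prob_space)
  from 1 2 show ?thesis by simp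
qed

text \<open>
  On the event \<open>T j\<close> that level \<open>\<delta>\<close> is first passed at the \<open>j\<close>-th grid point, which belongs to the past at that point,
  only the position there matters for the conditional expectation of the reflected payoff at time \<open>t\<close>.
\<close>

lemma first_passage_bound:
  fixes N :: nat
  assumes t: "0 < t" and kN: "j \<le> N" "0 < N"
    and k [measurable]: "k \<in> borel_measurable borel"
    and bnd: "\<And>z. \<bar>drift_odd a k z\<bar> \<le> 1"
    and lip: "\<And>z w. \<bar>drift_odd a k z - drift_odd a k w\<bar> \<le> L * \<bar>z - w\<bar>"
    and Y: "\<And>s \<omega>. Y s \<omega> = x + B s \<omega> - a * s"
    and grid: "\<And>i. s i = t * real i / real N"
    and T: "\<And>j. T j = {\<omega>\<in>space M. (\<forall>i<j. Y (s i) \<omega> > \<delta>) \<and> Y (s j) \<omega> \<le> \<delta>}"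
  shows "\<bar>expectation (\<lambda>\<omega>. drift_odd a k (Y t \<omega>) * indicator (T j) \<omega>)\<bar>
    \<le> expectation (\<lambda>\<omega>. min 1 (L * \<bar>Y (s j) \<omega>\<bar>) * indicator (T j) \<omega>)"
proof -
  have s0: "0 \<le> s i" for i using t by (simp add: grid)
  have [measurable]: "B (s i) \<in> borel_measurable M" "B t \<in> borel_measurable M" for i
    using random_variable t s0 by auto
  have [measurable]: "T j \<in> sets M" unfolding T Y by measurable
  have [measurable]: "Y (s i) \<in> borel_measurable M" "Y t \<in> borel_measurable M" for i unfolding Y by measurable
  have L0: "0 \<le> L * \<bar>y\<bar>" for y using lip[of y 0] by auto
  show ?thesis
  proof (cases "j = N")
    case True
    then have sj: "s j = t" using kN by (simp add: grid)
    have d0: "drift_odd a k 0 = 0" by (simp add: drift_odd_def)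
    have b: "\<bar>drift_odd a k z\<bar> \<le> min 1 (L * \<bar>z\<bar>)" for z
      using bnd[of z] lip[of z 0] by (simp add: d0)
    have "\<bar>expectation (\<lambda>\<omega>. drift_odd a k (Y t \<omega>) * indicator (T j) \<omega>)\<bar>
       \<le> expectation (\<lambda>\<omega>. \<bar>drift_odd a k (Y t \<omega>) * indicator (T j) \<omega>\<bar>)"
      by (rule integral_abs_bound)
    also have "\<dots> \<le> expectation (\<lambda>\<omega>. min 1 (L * \<bar>Y (s j) \<omega>\<bar>) * indicator (T j) \<omega>)"
    proof (rule integral_mono')
      show "integrable M (\<lambda>\<omega>. min 1 (L * \<bar>Y (s j) \<omega>\<bar>) * indicator (T j) \<omega>)"
        by (rule integrable_const_bound[where B=1]) (use L0 in \<open>auto split: split_indicator\<close>)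
      show "\<bar>drift_odd a k (Y t \<omega>) * indicator (T j) \<omega>\<bar> \<le> min 1 (L * \<bar>Y (s j) \<omega>\<bar>) * indicator (T j) \<omega>" for \<omega>
        using b[of "Y t \<omega>"] by (auto simp: sj split: split_indicator)
    qed (use L0 in \<open>auto split: split_indicator\<close>)
    finally show ?thesis .
  next
    case False
    with kN have jN: "j < N" by simp
    have s00: "s 0 = 0" by (simp add: grid)
    have sm: "s i < s i'" if "i < i'" for i i'
      using that t kN by (simp add: grid divide_strict_right_mono)
    have sjt: "s j < t" using sm[OF jN] kN by (simp add: grid)
    \<comment> \<open>The partition \<open>s 0 < \<dots> < s j < t\<close>: the first \<open>j\<close> increments determine the past on the grid, and the last one,
        which skips the remaining grid points, is the future.\<close>
    define u where "u i = (if i \<le> j then s i else t)" for i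
    define D where "D i \<omega> = B (u (Suc i)) \<omega> - B (u i) \<omega>" for i \<omega>
    have ind: "indep_vars (\<lambda>_. borel) D {..<Suc j}"
      unfolding D_def
    proof (rule indep_increments)
      show "0 \<le> u 0" using s0 by (simp add: u_def)
      show "u i < u (Suc i)" if "i < Suc j" for i
        using that sm[of i "Suc i"] sjt by (auto simp: u_def less_Suc_eq)
    qed
    define S where "S = (\<Pi>\<^sub>M i\<in>{..<j}. (borel :: real measure))"
    define V where "V \<omega> = restrict (\<lambda>i. D i \<omega>) {..<j}" for \<omega>
    define S' where "S' = (\<Pi>\<^sub>M i\<in>{j}. (borel :: real measure))"
    define W where "W \<omega> = restrict (\<lambda>i. D i \<omega>) {j}" for \<omega>
    define h where "h w = w j - a * (t - s j)" for w :: "nat \<Rightarrow> real"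
    have h [measurable]: "h \<in> borel_measurable S'"
      unfolding h_def[abs_def] S'_def by measurable
    have hW: "h (W \<omega>) = B t \<omega> - B (s j) \<omega> - a * (t - s j)" for \<omega>
      by (simp add: h_def W_def D_def u_def)
    have "indep_var S V S' W"
      unfolding V_def S_def W_def S'_def by (rule indep_var_restrict[OF ind]) auto
    then have VW: "V \<in> measurable M S" "W \<in> measurable M S'"
      "distr M S V \<Otimes>\<^sub>M distr M S' W = distr M (S \<Otimes>\<^sub>M S') (\<lambda>\<omega>. (V \<omega>, W \<omega>))"
      unfolding indep_var_distribution_eq by auto
    define y where "y i v = x + (\<Sum>l<i. v l) - a * s i" for i and v :: "nat \<Rightarrow> real"
    have y [measurable]: "y i \<in> borel_measurable S" if "i \<le> j" for i
      unfolding y_def[abs_def] S_def using that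
      by (intro borel_measurable_diff borel_measurable_add borel_measurable_sum measurable_component_singleton) auto
    define A where "A = {v\<in>space S. (\<forall>i<j. y i v > \<delta>) \<and> y j v \<le> \<delta>}"
    have A [measurable]: "A \<in> sets S"
      unfolding A_def by measurable
    have yV: "y i (V \<omega>) = Y (s i) \<omega>" if "i \<le> j" "\<omega> \<in> space M" for i \<omega>
    proof -
      have "(\<Sum>l<i. V \<omega> l) = (\<Sum>l<i. B (s (Suc l)) \<omega> - B (s l) \<omega>)"
        using that by (intro sum.cong) (auto simp: V_def D_def u_def)
      also have "\<dots> = B (s i) \<omega>"
        using start_zero[OF that(2)] s00 by (subst sum_lessThan_telescope) simp
      finally show ?thesis by (simp add: y_def Y)
    qed
    have VS: "V \<omega> \<in> space S" for \<omega> by (simp add: V_def S_def space_PiM)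
    have AV: "indicator A (V \<omega>) = (indicator (T j) \<omega> :: real)" if "\<omega> \<in> space M" for \<omega>
      using that VS by (auto simp: A_def T yV indicator_def)
    have "\<bar>expectation (\<lambda>\<omega>. drift_odd a k (y j (V \<omega>) + h (W \<omega>)) * indicator A (V \<omega>))\<bar>
      \<le> expectation (\<lambda>\<omega>. min 1 (L * \<bar>y j (V \<omega>)\<bar>) * indicator A (V \<omega>))"
    proof (rule product_law_integral_bound[OF VW, where H = "\<lambda>y. min 1 (L * \<bar>y\<bar>)"])
      show "\<bar>expectation (\<lambda>\<omega>. drift_odd a k (y + h (W \<omega>)))\<bar> \<le> min 1 (L * \<bar>y\<bar>)" for y
        unfolding hW by (rule expectation_drift_odd_lipschitz[OF s0 sjt k bnd lip])
      show "\<bar>min 1 (L * \<bar>z\<bar>)\<bar> \<le> 1" for z using L0[of z] by simp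
    qed (use y[of j] bnd A h in auto)
    also have "expectation (\<lambda>\<omega>. min 1 (L * \<bar>y j (V \<omega>)\<bar>) * indicator A (V \<omega>))
       = expectation (\<lambda>\<omega>. min 1 (L * \<bar>Y (s j) \<omega>\<bar>) * indicator (T j) \<omega>)"
      by (intro Bochner_Integration.integral_cong) (auto simp: yV AV)
    also have "expectation (\<lambda>\<omega>. drift_odd a k (y j (V \<omega>) + h (W \<omega>)) * indicator A (V \<omega>))
      = expectation (\<lambda>\<omega>. drift_odd a k (Y t \<omega>) * indicator (T j) \<omega>)"
      by (intro Bochner_Integration.integral_cong refl) (simp add: yV AV, simp add: Y hW algebra_simps)
    finally show ?thesis .
  qed
qed

end

section \<open>From dyadic grids to continuous time\<close>

lemma dyadic_below:
  fixes p :: "real \<Rightarrow> real"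
  assumes t: "0 < t" and p: "continuous_on {0..t} p" and s: "s \<in> {0..t}" and d: "p s < d"
  shows "\<exists>n. \<exists>j\<le>(2::nat)^n. p (t * real j / 2^n) < d"
proof -
  define j where "j n = nat \<lfloor>s * 2^n / t\<rfloor>" for n :: nat
  define r where "r n = t * real (j n) / 2^n" for n :: nat
  have jr: "real (j n) = of_int \<lfloor>s * 2^n / t\<rfloor>" for n
    using s t by (simp add: j_def)
  have up: "r n \<le> s" for n
  proof -
    have "real (j n) \<le> s * 2^n / t" unfolding jr by linarith
    then show ?thesis using t by (simp add: r_def field_simps)
  qed
  have lo: "s - t * (1/2)^n \<le> r n" for n
  proof -
    have "s * 2^n / t - 1 \<le> real (j n)" unfolding jr by linarith
    then have "s * 2^n \<le> t + t * real (j n)" using t by (simp add: field_simps)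
    then have "s * 2^n / 2^n \<le> (t + t * real (j n)) / 2^n" by (rule divide_right_mono) simp
    then show ?thesis by (simp add: r_def power_one_over add_divide_distrib)
  qed
  have "(\<lambda>n. s - t * (1/2)^n) \<longlonglongrightarrow> s - t * 0"
    by (intro tendsto_intros LIMSEQ_power_zero) auto
  then have lim: "r \<longlonglongrightarrow> s"
    by (intro tendsto_sandwich[of "\<lambda>n. s - t * (1/2)^n" r sequentially "\<lambda>_. s"])
      (use up lo in auto)
  have r: "r n \<in> {0..t}" for n
    using up[of n] s t by (simp add: r_def)
  have "(\<lambda>n. p (r n)) \<longlonglongrightarrow> p s"
    using r by (intro continuous_on_tendsto_compose[OF p lim s]) auto
  then have "eventually (\<lambda>n. p (r n) < d) sequentially"
    using d by (rule order_tendstoD)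
  then obtain n where n: "p (r n) < d" by (auto simp: eventually_sequentially)
  have "real (j n) \<le> 2^n"
    using r[of n] t by (simp add: r_def field_simps)
  then have "j n \<le> 2^n" using of_nat_le_iff[of "j n" "2^n", where 'a=real] by simp
  with n show ?thesis unfolding r_def by blast
qed

text \<open>
  This expresses the hitting event through countably many times, which gives its measurability. The positive
  levels are essential: a path may touch \<open>0\<close> at a single time that lies on no grid.
\<close>

lemma path_hits_iff:
  fixes p :: "real \<Rightarrow> real"
  assumes t: "0 < t" and p: "continuous_on {0..t} p"
  shows "(\<exists>s\<in>{0..t}. p s \<le> 0) \<longleftrightarrow>
    (\<forall>m. \<exists>n. \<exists>j\<le>(2::nat)^n. p (t * real j / 2^n) \<le> 1 / real (Suc m))"
proof
  assume "\<exists>s\<in>{0..t}. p s \<le> 0"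
  then obtain s where s: "s \<in> {0..t}" "p s \<le> 0" by auto
  have "p s < 1 / real (Suc m)" for m using s(2) by (rule le_less_trans) simp
  from dyadic_below[OF t p s(1) this]
  show "\<forall>m. \<exists>n. \<exists>j\<le>(2::nat)^n. p (t * real j / 2^n) \<le> 1 / real (Suc m)"
    by (meson less_imp_le)
next
  assume *: "\<forall>m. \<exists>n. \<exists>j\<le>(2::nat)^n. p (t * real j / 2^n) \<le> 1 / real (Suc m)"
  have "\<exists>s\<in>{0..t}. \<forall>y\<in>{0..t}. p s \<le> p y"
    using t p by (intro continuous_attains_inf) auto
  then obtain s where s: "s \<in> {0..t}" and min: "\<And>y. y \<in> {0..t} \<Longrightarrow> p s \<le> p y" by blast
  have le: "p s \<le> 1 / real (Suc m)" for m
  proof -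
    from * obtain n j where nj: "j \<le> (2::nat)^n" "p (t * real j / 2^n) \<le> 1 / real (Suc m)" by blast
    have "real j \<le> 2^n" using of_nat_mono[OF nj(1), where 'a=real] by simp
    then have "t * real j / 2^n \<in> {0..t}" using t by (simp add: field_simps)
    from min[OF this] nj(2) show ?thesis by simp
  qed
  have "p s \<le> 0"
    by (rule LIMSEQ_le_const[OF LIMSEQ_inverse_real_of_nat]) (use le in \<open>auto simp: inverse_eq_divide\<close>)
  with s show "\<exists>s\<in>{0..t}. p s \<le> 0" by auto
qed

text \<open>
  The first-passage events are disjoint, and their union is the event that \<open>Q\<close> occurs up to \<open>N\<close>. The case
  \<open>f = (\<lambda>_. c)\<close> splits an expectation over the time of first passage.
\<close>

lemma sum_first_occurrence:
  fixes f :: "nat \<Rightarrow> real"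
  shows "(\<Sum>j\<le>N. f j * of_bool ((\<forall>i<j. \<not> Q i) \<and> Q j)) =
    (if \<exists>j\<le>N. Q j then f (LEAST j. Q j) else 0)"
proof (cases "\<exists>j\<le>N. Q j")
  case True
  then obtain j0 where j0: "j0 \<le> N" "Q j0" by blast
  let ?l = "LEAST j. Q j"
  have l: "Q ?l" "?l \<le> N" using j0 LeastI[of Q j0] Least_le[of Q j0] by auto
  have iff: "(\<forall>i<j. \<not> Q i) \<and> Q j \<longleftrightarrow> j = ?l" for j
    using l(1) Least_le[of Q] not_less_Least[of _ Q]
    by (metis linorder_neqE_nat)
  have "(\<Sum>j\<le>N. f j * of_bool ((\<forall>i<j. \<not> Q i) \<and> Q j)) = (\<Sum>j\<le>N. if j = ?l then f j else 0)"
    unfolding iff by (intro sum.cong) auto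
  also have "\<dots> = f ?l" using l by simp
  finally show ?thesis using True by simp
next
  case False
  then show ?thesis by (auto intro!: sum.neutral)
qed

text \<open>
  At the first grid point where the path is at most \<open>\<delta>\<close> it has fallen below \<open>\<delta>\<close> by no more than its oscillation over
  one grid step, and that tends to \<open>0\<close> by uniform continuity. If this happens at time \<open>0\<close>, the starting
  value already lies between \<open>0\<close> and \<open>\<delta>\<close>.
\<close>

lemma overshoot_vanishes:
  fixes p :: "real \<Rightarrow> real"
  assumes t: "0 < t" and p: "continuous_on {0..t} p" and p0: "0 \<le> p 0" and \<delta>: "0 \<le> \<delta>" and L: "0 \<le> L"
  defines "Q \<equiv> \<lambda>n j. p (t * real j / 2^n) \<le> \<delta>"
  shows "(\<lambda>n. max 0 ((\<Sum>j\<le>(2::nat)^n. min 1 (L * \<bar>p (t * real j / 2^n)\<bar>)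
     * of_bool ((\<forall>i<j. \<not> Q n i) \<and> Q n j)) - L * \<delta>)) \<longlonglongrightarrow> 0"
proof (rule LIMSEQ_I)
  fix e :: real assume e: "0 < e"
  \<comment> \<open>\<open>L + 1\<close> instead of \<open>L\<close>, which may be \<open>0\<close>.\<close>
  define \<eta> where "\<eta> = e / (L + 1)"
  have \<eta>: "0 < \<eta>" "L * \<eta> < e" using e L by (auto simp: \<eta>_def field_simps)
  have "uniformly_continuous_on {0..t} p"
    using p by (intro compact_uniformly_continuous) auto
  then obtain d where d: "0 < d"
    "\<And>r s. r \<in> {0..t} \<Longrightarrow> s \<in> {0..t} \<Longrightarrow> dist s r < d \<Longrightarrow> dist (p s) (p r) < \<eta>"
    using \<eta>(1) unfolding uniformly_continuous_on_def by metis
  have "(\<lambda>n. t * (1/2)^n) \<longlonglongrightarrow> t * 0"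
    by (intro tendsto_intros LIMSEQ_power_zero) auto
  then have "eventually (\<lambda>n. t * (1/2)^n < d) sequentially"
    using d(1) by (auto dest: order_tendstoD)
  then obtain n0 where n0: "\<And>n. n \<ge> n0 \<Longrightarrow> t * (1/2)^n < d"
    by (auto simp: eventually_sequentially)
  have "norm (max 0 ((\<Sum>j\<le>(2::nat)^n. min 1 (L * \<bar>p (t * real j / 2^n)\<bar>)
     * of_bool ((\<forall>i<j. \<not> Q n i) \<and> Q n j)) - L * \<delta>) - 0) < e" if n: "n \<ge> n0" for n
  proof (cases "\<exists>j\<le>2^n. Q n j")
    case True
    define l where "l = (LEAST j. Q n j)"
    from True have l: "Q n l" "l \<le> 2^n"
      unfolding l_def by (blast intro: LeastI, blast intro: order.trans Least_le)
    have before: "\<not> Q n i" if "i < l" for i using that not_less_Least unfolding l_def by blast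
    have grid: "t * real i / 2^n \<in> {0..t}" if "i \<le> l" for i
    proof -
      have "real i \<le> real (2^n)" using that l(2) by (intro of_nat_mono) simp
      then show ?thesis using t by (simp add: field_simps)
    qed
    have "\<bar>p (t * real l / 2^n)\<bar> \<le> \<delta> + \<eta>"
    proof (cases l)
      case 0
      then show ?thesis using l p0 \<eta> by (simp add: Q_def)
    next
      case (Suc i)
      have "dist (t * real i / 2^n) (t * real l / 2^n) < d"
        using n0[OF n] t by (simp add: Suc dist_real_def field_simps abs_if)
      then have "dist (p (t * real i / 2^n)) (p (t * real l / 2^n)) < \<eta>"
        using grid[of i] grid[of l] by (intro d) (auto simp: Suc)
      then show ?thesis
        using before[of i] l(1) \<delta> by (auto simp: Suc Q_def dist_real_def)
    qed
    then have "L * \<bar>p (t * real l / 2^n)\<bar> \<le> L * (\<delta> + \<eta>)"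
      using L by (rule mult_left_mono)
    also have "\<dots> < L * \<delta> + e" using \<eta> by (simp add: algebra_simps)
    finally show ?thesis
      using e True unfolding sum_first_occurrence by (auto simp: l_def)
  next
    case False
    then have F: "(\<exists>j\<le>2^n. Q n j) = False" by simp
    show ?thesis using e L \<delta> unfolding sum_first_occurrence F if_False by simp
  qed
  then show "\<exists>no. \<forall>n\<ge>no. norm (max 0 ((\<Sum>j\<le>(2::nat)^n. min 1 (L * \<bar>p (t * real j / 2^n)\<bar>)
     * of_bool ((\<forall>i<j. \<not> Q n i) \<and> Q n j)) - L * \<delta>) - 0) < e" by blast
qed

lemma dyadic_nested:
  assumes "\<exists>j\<le>(2::nat)^n. P (t * real j / 2^n)" "n \<le> n'"
  shows "\<exists>j\<le>(2::nat)^n'. P (t * real j / 2^n')"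
  using assms(2,1)
proof (induction n' rule: dec_induct)
  case (step n')
  then obtain j where j: "j \<le> (2::nat)^n'" "P (t * real j / 2^n')" by blast
  have "t * real (2 * j) / 2^Suc n' = t * real j / 2^n'" by simp
  with j show ?case by (intro exI[of _ "2 * j"]) auto
qed

lemma eventually_of_bool_mono:
  assumes "\<And>n n'. n \<le> n' \<Longrightarrow> P n \<Longrightarrow> P n'"
  shows "(\<lambda>n. of_bool (P n) :: real) \<longlonglongrightarrow> of_bool (\<exists>n. P n)"
proof (rule tendsto_eventually)
  show "eventually (\<lambda>n. of_bool (P n) = (of_bool (\<exists>n. P n) :: real)) sequentially"
  proof (cases "\<exists>n. P n")
    case True
    then obtain n0 where "P n0" by blast
    then have "P n" if "n \<ge> n0" for n using assms that by blast
    with True show ?thesis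
      by (intro eventually_sequentiallyI[of n0]) simp
  qed simp
qed

context standard_brownian_motion
begin

text \<open>
  The paths that hit \<open>0\<close> before time \<open>t\<close> contribute nothing to the expectation of the reflected payoff. Level \<open>\<delta> > 0\<close>
  is treated by letting the mesh of the grid tend to \<open>0\<close>, with error \<open>L * \<delta>\<close>; afterwards \<open>\<delta>\<close> tends to \<open>0\<close>. The order
  of the two limits matters, since the grid may miss the zeros of the path.
\<close>

lemma hitting_part_vanishes:
  assumes t: "0 < t" and a: "0 \<le> a" and x: "0 \<le> x"
    and k [measurable]: "k \<in> borel_measurable borel"
    and k01: "\<And>z. 0 \<le> k z" "\<And>z. k z \<le> 1" "\<And>z. z \<le> 0 \<Longrightarrow> k z = 0"
    and lip: "\<And>z w. \<bar>k z - k w\<bar> \<le> m * \<bar>z - w\<bar>"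
    and Y: "\<And>s \<omega>. Y s \<omega> = x + B s \<omega> - a * s"
  shows "expectation (\<lambda>\<omega>. drift_odd a k (Y t \<omega>) * of_bool (\<exists>s\<in>{0..t}. Y s \<omega> \<le> 0)) = 0"
proof -
  let ?F = "drift_odd a k"
  define L where "L = 2 * m + 2 * a"
  have bnd: "\<bar>?F z\<bar> \<le> 1" for z using a k01 by (rule drift_odd_bounded)
  have lipF: "\<bar>?F z - ?F w\<bar> \<le> L * \<bar>z - w\<bar>" for z w
    unfolding L_def using a k01 lip by (rule drift_odd_lipschitz)
  have L0: "0 \<le> L" using lipF[of 1 0] by simp
  have mB [measurable]: "B (t * real j / 2^n) \<in> borel_measurable M" for j n
    using t by (intro random_variable) simp
  have [measurable]: "B t \<in> borel_measurable M" using t by (intro random_variable) simp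
  have mY [measurable]: "Y (t * real j / 2^n) \<in> borel_measurable M" "Y t \<in> borel_measurable M" for j n
    unfolding Y by measurable
  have cont: "continuous_on {0..t} (\<lambda>s. Y s \<omega>)" if "\<omega> \<in> space M" for \<omega>
    unfolding Y using continuous_paths[OF that]
    by (intro continuous_intros) (auto elim: continuous_on_subset)
  define Q where "Q n \<delta> \<omega> \<longleftrightarrow> (\<exists>j\<le>(2::nat)^n. Y (t * real j / 2^n) \<omega> \<le> \<delta>)" for n \<delta> \<omega>
  have [measurable]: "Measurable.pred M (Q n \<delta>)" for n \<delta> unfolding Q_def by measurable
  have Qmono: "Q n' \<delta> \<omega>" if "n \<le> n'" "Q n \<delta> \<omega>" for n n' \<delta> \<omega>
    using dyadic_nested[of n "\<lambda>r. Y r \<omega> \<le> \<delta>" t n'] that unfolding Q_def by blast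
  have bndI: "norm (?F (Y t \<omega>) * of_bool P) \<le> 1" for \<omega> P
    using bnd by (auto simp: abs_mult)

  have level: "\<bar>expectation (\<lambda>\<omega>. ?F (Y t \<omega>) * of_bool (\<exists>n. Q n \<delta> \<omega>))\<bar> \<le> L * \<delta>" if \<delta>: "0 < \<delta>" for \<delta>
  proof -
    define T where "T n j = {\<omega>\<in>space M. (\<forall>i<j. Y (t * real i / 2^n) \<omega> > \<delta>)
       \<and> Y (t * real j / 2^n) \<omega> \<le> \<delta>}" for n j :: nat
    have [measurable]: "T n j \<in> sets M" for n j unfolding T_def by measurable
    have indT: "indicator (T n j) \<omega> = (of_bool ((\<forall>i<j. \<not> Y (t * real i / 2^n) \<omega> \<le> \<delta>)
       \<and> Y (t * real j / 2^n) \<omega> \<le> \<delta>) :: real)" if "\<omega> \<in> space M" for n j \<omega>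
      using that by (auto simp: T_def indicator_def not_le)
    define W where "W n \<omega> = (\<Sum>j\<le>(2::nat)^n. min 1 (L * \<bar>Y (t * real j / 2^n) \<omega>\<bar>) * indicator (T n j) \<omega>)"
      for n \<omega>
    have [measurable]: "W n \<in> borel_measurable M" for n unfolding W_def by measurable
    have W01: "0 \<le> W n \<omega>" "W n \<omega> \<le> 1" if "\<omega> \<in> space M" for n \<omega>
      using L0 unfolding W_def indT[OF that] sum_first_occurrence by auto
    have Wint: "integrable M (W n)" for n
      by (rule integrable_const_bound[where B=1]) (use W01 in auto)
    have Wint': "integrable M (\<lambda>\<omega>. max 0 (W n \<omega> - L * \<delta>))" for n
      by (rule integrable_const_bound[where B="1 + L * \<delta>"])
        (use W01 L0 \<delta> in \<open>auto intro!: AE_I2 simp: abs_if max_def add_increasing2 add_increasing\<close>)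
    have step: "\<bar>expectation (\<lambda>\<omega>. ?F (Y t \<omega>) * of_bool (Q n \<delta> \<omega>))\<bar>
        \<le> L * \<delta> + expectation (\<lambda>\<omega>. max 0 (W n \<omega> - L * \<delta>))" for n
    proof -
      have fp: "\<bar>expectation (\<lambda>\<omega>. ?F (Y t \<omega>) * indicator (T n j) \<omega>)\<bar>
         \<le> expectation (\<lambda>\<omega>. min 1 (L * \<bar>Y (t * real j / 2^n) \<omega>\<bar>) * indicator (T n j) \<omega>)"
        if "j \<le> 2^n" for j
        by (rule first_passage_bound[where N="2^n" and s = "\<lambda>i. t * real i / 2^n" and x=x and \<delta>=\<delta>])
          (use t that bnd lipF in \<open>auto simp: Y T_def\<close>)
      have i1: "integrable M (\<lambda>\<omega>. ?F (Y t \<omega>) * indicator (T n j) \<omega>)" for j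
        by (rule integrable_const_bound[where B=1]) (use bnd in \<open>auto simp: abs_mult indicator_def\<close>)
      have i2: "integrable M (\<lambda>\<omega>. min 1 (L * \<bar>Y (t * real j / 2^n) \<omega>\<bar>) * indicator (T n j) \<omega>)" for j
        by (rule integrable_const_bound[where B=1]) (use L0 in \<open>auto simp: indicator_def\<close>)
      have "?F (Y t \<omega>) * of_bool (Q n \<delta> \<omega>) = (\<Sum>j\<le>2^n. ?F (Y t \<omega>) * indicator (T n j) \<omega>)"
        if "\<omega> \<in> space M" for \<omega>
        unfolding indT[OF that] sum_first_occurrence Q_def by simp
      then have "expectation (\<lambda>\<omega>. ?F (Y t \<omega>) * of_bool (Q n \<delta> \<omega>))
         = expectation (\<lambda>\<omega>. \<Sum>j\<le>2^n. ?F (Y t \<omega>) * indicator (T n j) \<omega>)"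
        by (intro Bochner_Integration.integral_cong) auto
      also have "\<dots> = (\<Sum>j\<le>2^n. expectation (\<lambda>\<omega>. ?F (Y t \<omega>) * indicator (T n j) \<omega>))"
        by (intro Bochner_Integration.integral_sum i1)
      finally have "\<bar>expectation (\<lambda>\<omega>. ?F (Y t \<omega>) * of_bool (Q n \<delta> \<omega>))\<bar>
         \<le> (\<Sum>j\<le>2^n. expectation (\<lambda>\<omega>. min 1 (L * \<bar>Y (t * real j / 2^n) \<omega>\<bar>) * indicator (T n j) \<omega>))"
        using fp by (auto intro!: order.trans[OF sum_abs] sum_mono)
      also have "\<dots> = expectation (W n)"
        unfolding W_def by (intro Bochner_Integration.integral_sum[symmetric] i2)
      also have "\<dots> \<le> expectation (\<lambda>\<omega>. L * \<delta> + max 0 (W n \<omega> - L * \<delta>))"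
        by (intro integral_mono Wint Wint' Bochner_Integration.integrable_add) auto
      also have "\<dots> = L * \<delta> + expectation (\<lambda>\<omega>. max 0 (W n \<omega> - L * \<delta>))"
        by (subst Bochner_Integration.integral_add) (auto simp: Wint' prob_space)
      finally show ?thesis .
    qed
    have "(\<lambda>n. expectation (\<lambda>\<omega>. max 0 (W n \<omega> - L * \<delta>))) \<longlonglongrightarrow> expectation (\<lambda>\<omega>. 0)"
    proof (rule integral_dominated_convergence[where w="\<lambda>_. 1 + L * \<delta>"])
      show "AE \<omega> in M. (\<lambda>n. max 0 (W n \<omega> - L * \<delta>)) \<longlonglongrightarrow> 0"
      proof (rule AE_I2)
        fix \<omega> assume \<omega>: "\<omega> \<in> space M"
        show "(\<lambda>n. max 0 (W n \<omega> - L * \<delta>)) \<longlonglongrightarrow> 0"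
          unfolding W_def indT[OF \<omega>]
          using overshoot_vanishes[OF t cont[OF \<omega>], of \<delta> L] \<delta> L0 x start_zero[OF \<omega>] by (simp add: Y)
      qed
      show "AE \<omega> in M. norm (max 0 (W n \<omega> - L * \<delta>)) \<le> 1 + L * \<delta>" for n
        using W01 L0 \<delta> by (auto intro!: AE_I2 simp: abs_if max_def add_increasing2 add_increasing)
    qed auto
    then have lim1: "(\<lambda>n. L * \<delta> + expectation (\<lambda>\<omega>. max 0 (W n \<omega> - L * \<delta>))) \<longlonglongrightarrow> L * \<delta> + 0"
      by (intro tendsto_intros) simp
    have lim2: "(\<lambda>n. \<bar>expectation (\<lambda>\<omega>. ?F (Y t \<omega>) * of_bool (Q n \<delta> \<omega>))\<bar>)
       \<longlonglongrightarrow> \<bar>expectation (\<lambda>\<omega>. ?F (Y t \<omega>) * of_bool (\<exists>n. Q n \<delta> \<omega>))\<bar>"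
    proof (intro tendsto_rabs integral_dominated_convergence[where w="\<lambda>_. 1"])
      show "AE \<omega> in M. (\<lambda>n. ?F (Y t \<omega>) * of_bool (Q n \<delta> \<omega>)) \<longlonglongrightarrow> ?F (Y t \<omega>) * of_bool (\<exists>n. Q n \<delta> \<omega>)"
        using Qmono by (intro AE_I2 tendsto_mult tendsto_const eventually_of_bool_mono) blast
    qed (use bndI in auto)
    show ?thesis
      using LIMSEQ_le[OF lim2 lim1] step by auto
  qed

  have "(\<lambda>m. expectation (\<lambda>\<omega>. ?F (Y t \<omega>) * of_bool (\<exists>n. Q n (1 / real (Suc m)) \<omega>)))
      \<longlonglongrightarrow> expectation (\<lambda>\<omega>. ?F (Y t \<omega>) * of_bool (\<forall>m. \<exists>n. Q n (1 / real (Suc m)) \<omega>))"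
  proof (intro integral_dominated_convergence[where w="\<lambda>_. 1"])
    have mono: "\<exists>n. Q n (1 / real (Suc l)) \<omega>" if "\<exists>n. Q n (1 / real (Suc l')) \<omega>" "l \<le> l'" for l l' \<omega>
    proof -
      have "1 / real (Suc l') \<le> 1 / real (Suc l)" using that(2) by (intro divide_left_mono) auto
      then show ?thesis using that(1) unfolding Q_def by (meson order.trans)
    qed
    have "(\<lambda>l. of_bool (\<exists>n. Q n (1 / real (Suc l)) \<omega>) :: real)
       \<longlonglongrightarrow> of_bool (\<forall>m. \<exists>n. Q n (1 / real (Suc m)) \<omega>)" for \<omega>
    proof (rule tendsto_eventually)
      show "eventually (\<lambda>l. of_bool (\<exists>n. Q n (1 / real (Suc l)) \<omega>)
        = (of_bool (\<forall>m. \<exists>n. Q n (1 / real (Suc m)) \<omega>) :: real)) sequentially"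
      proof (cases "\<forall>m. \<exists>n. Q n (1 / real (Suc m)) \<omega>")
        case False
        then obtain l0 where l0: "\<not> (\<exists>n. Q n (1 / real (Suc l0)) \<omega>)" by blast
        then have "\<not> (\<exists>n. Q n (1 / real (Suc l)) \<omega>)" if "l \<ge> l0" for l
          using mono that by blast
        then show ?thesis using False
          by (intro eventually_sequentiallyI[of l0]) (simp del: of_nat_Suc)
      qed simp
    qed
    then show "AE \<omega> in M. (\<lambda>l. ?F (Y t \<omega>) * of_bool (\<exists>n. Q n (1 / real (Suc l)) \<omega>))
       \<longlonglongrightarrow> ?F (Y t \<omega>) * of_bool (\<forall>m. \<exists>n. Q n (1 / real (Suc m)) \<omega>)"
      by (intro AE_I2 tendsto_mult tendsto_const)
  qed (use bndI in auto)
  moreover have "(\<lambda>m. expectation (\<lambda>\<omega>. ?F (Y t \<omega>) * of_bool (\<exists>n. Q n (1 / real (Suc m)) \<omega>))) \<longlonglongrightarrow> 0"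
  proof (rule Lim_null_comparison)
    show "eventually (\<lambda>m. norm (expectation (\<lambda>\<omega>. ?F (Y t \<omega>) * of_bool (\<exists>n. Q n (1 / real (Suc m)) \<omega>)))
        \<le> L * inverse (real (Suc m))) sequentially"
      using level[of "1 / real (Suc m)" for m]
      by (intro always_eventually allI) (simp add: inverse_eq_divide del: of_nat_Suc)
    show "(\<lambda>m. L * inverse (real (Suc m))) \<longlonglongrightarrow> 0"
      using tendsto_mult[OF tendsto_const[of L] LIMSEQ_inverse_real_of_nat] by simp
  qed
  ultimately have "expectation (\<lambda>\<omega>. ?F (Y t \<omega>) * of_bool (\<forall>m. \<exists>n. Q n (1 / real (Suc m)) \<omega>)) = 0"
    by (rule LIMSEQ_unique)
  moreover have "(\<exists>s\<in>{0..t}. Y s \<omega> \<le> 0) \<longleftrightarrow> (\<forall>m. \<exists>n. Q n (1 / real (Suc m)) \<omega>)"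
    if "\<omega> \<in> space M" for \<omega>
    unfolding Q_def by (rule path_hits_iff[OF t cont[OF that]])
  ultimately show ?thesis
    by (simp cong: Bochner_Integration.integral_cong)
qed

end

section \<open>Survival probability and position at a fixed time\<close>

text \<open>
  Lipschitz approximations of the indicator of \<open>(y, \<infinity>)\<close>.
\<close>

definition ramp :: "nat \<Rightarrow> real \<Rightarrow> real \<Rightarrow> real" where
  "ramp m y z = min 1 (max 0 (real m * (z - y)))"

lemma ramp_measurable [measurable]: "ramp m y \<in> borel_measurable borel"
  unfolding ramp_def by measurable

lemma ramp_bounds: "0 \<le> ramp m y z" "ramp m y z \<le> 1"
  by (auto simp: ramp_def)

lemma ramp_eq_0: "z \<le> y \<Longrightarrow> ramp m y z = 0"
  by (simp add: ramp_def mult_nonneg_nonpos)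

lemma ramp_lipschitz: "\<bar>ramp m y z - ramp m y w\<bar> \<le> real m * \<bar>z - w\<bar>"
proof -
  have "\<bar>min 1 (max 0 u) - min 1 (max 0 v)\<bar> \<le> \<bar>u - v\<bar>" for u v :: real by auto
  from this[of "real m * (z - y)" "real m * (w - y)"]
  show ?thesis by (simp add: ramp_def abs_mult flip: right_diff_distrib)
qed

lemma ramp_tendsto: "(\<lambda>m. ramp m y z) \<longlonglongrightarrow> indicator {y<..} z"
proof (cases "y < z")
  case True
  obtain m0 where m0: "1 / (z - y) < real m0" using reals_Archimedean2 by blast
  have "ramp m y z = 1" if "m0 \<le> m" for m
  proof -
    have "1 / (z - y) < real m" using m0 that by linarith
    then have "1 < real m * (z - y)" using True by (simp add: field_simps)
    then show ?thesis by (simp add: ramp_def)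
  qed
  then show ?thesis using True
    by (intro tendsto_eventually eventually_sequentiallyI[of m0]) simp
next
  case False
  then show ?thesis by (simp add: ramp_eq_0)
qed

lemma drift_odd_tendsto:
  assumes "\<And>z. (\<lambda>m. k m z) \<longlonglongrightarrow> l z"
  shows "(\<lambda>m. drift_odd a (k m) z) \<longlonglongrightarrow> drift_odd a l z"
  unfolding drift_odd_def by (intro tendsto_intros assms)

context standard_brownian_motion
begin

lemma pred_hits [measurable]:
  assumes "0 < t"
  shows "Measurable.pred M (\<lambda>\<omega>. \<exists>s\<in>{0..t}. x + B s \<omega> - a * s \<le> 0)"
proof -
  have [measurable]: "B (t * real j / 2^n) \<in> borel_measurable M" for j n
    using assms by (intro random_variable) simp
  have cont: "continuous_on {0..t} (\<lambda>s. x + B s \<omega> - a * s)" if "\<omega> \<in> space M" for \<omega>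
    using continuous_paths[OF that]
    by (intro continuous_intros) (auto elim: continuous_on_subset)
  have "Measurable.pred M (\<lambda>\<omega>. \<forall>m. \<exists>n. \<exists>j\<le>(2::nat)^n.
      x + B (t * real j / 2^n) \<omega> - a * (t * real j / 2^n) \<le> 1 / real (Suc m))"
    by measurable
  then show ?thesis
    by (rule measurable_cong[THEN iffD1, rotated]) (use path_hits_iff[OF assms cont] in blast)
qed

text \<open>
  On the event of survival \<open>Y t > 0\<close>, where the reflected payoff agrees with the payoff itself; on the complement the
  reflected payoff integrates to \<open>0\<close>.
\<close>

lemma survival_reflection:
  assumes t: "0 < t" and a: "0 \<le> a" and x: "0 \<le> x" and y: "0 \<le> y"
  shows "prob {\<omega>\<in>space M. (\<forall>s\<in>{0..t}. 0 < x + B s \<omega> - a * s) \<and> y < x + B t \<omega> - a * t}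
    = expectation (\<lambda>\<omega>. drift_odd a (indicator {y<..}) (x + B t \<omega> - a * t))"
proof -
  define Y where "Y s \<omega> = x + B s \<omega> - a * s" for s \<omega>
  define hit where "hit \<omega> \<longleftrightarrow> (\<exists>s\<in>{0..t}. Y s \<omega> \<le> 0)" for \<omega>
  have [measurable]: "B t \<in> borel_measurable M" using t by (intro random_variable) simp
  have [measurable]: "Y t \<in> borel_measurable M" unfolding Y_def by measurable
  have [measurable]: "Measurable.pred M hit" unfolding hit_def Y_def by (rule pred_hits[OF t])
  have bnd: "\<bar>drift_odd a (ramp m y) z\<bar> \<le> 1" for m z
    using a ramp_bounds ramp_eq_0 y by (intro drift_odd_bounded) auto
  have eq: "expectation (\<lambda>\<omega>. ramp m y (Y t \<omega>) * of_bool (\<not> hit \<omega>))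
      = expectation (\<lambda>\<omega>. drift_odd a (ramp m y) (Y t \<omega>))" for m
  proof -
    have i: "integrable M (\<lambda>\<omega>. drift_odd a (ramp m y) (Y t \<omega>) * of_bool (P \<omega>))"
      if [measurable]: "Measurable.pred M P" for P
      by (rule integrable_const_bound[where B=1]) (use bnd in \<open>auto simp: abs_mult of_bool_def\<close>)
    have "ramp m y (Y t \<omega>) * of_bool (\<not> hit \<omega>) = drift_odd a (ramp m y) (Y t \<omega>) * of_bool (\<not> hit \<omega>)" for \<omega>
    proof (cases "hit \<omega>")
      case False
      then have "0 < Y t \<omega>" using t by (auto simp: hit_def not_le)
      then show ?thesis using y by (simp add: drift_odd_def ramp_eq_0)
    qed simp
    then have "expectation (\<lambda>\<omega>. ramp m y (Y t \<omega>) * of_bool (\<not> hit \<omega>))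
       = expectation (\<lambda>\<omega>. drift_odd a (ramp m y) (Y t \<omega>) * of_bool (\<not> hit \<omega>))"
      by (intro Bochner_Integration.integral_cong refl)
    also have "\<dots> = expectation (\<lambda>\<omega>. drift_odd a (ramp m y) (Y t \<omega>) * of_bool (\<not> hit \<omega>))
       + expectation (\<lambda>\<omega>. drift_odd a (ramp m y) (Y t \<omega>) * of_bool (hit \<omega>))"
      unfolding hit_def
      using hitting_part_vanishes[OF t a x ramp_measurable ramp_bounds ramp_eq_0 ramp_lipschitz Y_def, of y m] y
      by simp
    also have "\<dots> = expectation (\<lambda>\<omega>. drift_odd a (ramp m y) (Y t \<omega>) * of_bool (\<not> hit \<omega>)
       + drift_odd a (ramp m y) (Y t \<omega>) * of_bool (hit \<omega>))"
      by (intro Bochner_Integration.integral_add[symmetric] i) measurable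
    also have "\<dots> = expectation (\<lambda>\<omega>. drift_odd a (ramp m y) (Y t \<omega>))"
      by (intro Bochner_Integration.integral_cong) auto
    finally show ?thesis .
  qed
  have l1: "(\<lambda>m. expectation (\<lambda>\<omega>. ramp m y (Y t \<omega>) * of_bool (\<not> hit \<omega>)))
     \<longlonglongrightarrow> expectation (\<lambda>\<omega>. indicator {y<..} (Y t \<omega>) * of_bool (\<not> hit \<omega>) :: real)"
    by (rule integral_dominated_convergence[where w="\<lambda>_. 1"])
      (use ramp_bounds in \<open>auto intro!: AE_I2 tendsto_mult ramp_tendsto simp: of_bool_def\<close>)
  have l2: "(\<lambda>m. expectation (\<lambda>\<omega>. drift_odd a (ramp m y) (Y t \<omega>)))
     \<longlonglongrightarrow> expectation (\<lambda>\<omega>. drift_odd a (indicator {y<..}) (Y t \<omega>))"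
    by (rule integral_dominated_convergence[where w="\<lambda>_. 1"])
      (use bnd in \<open>auto intro!: AE_I2 drift_odd_tendsto ramp_tendsto\<close>)
  have "expectation (\<lambda>\<omega>. indicator {y<..} (Y t \<omega>) * of_bool (\<not> hit \<omega>) :: real)
     = expectation (\<lambda>\<omega>. drift_odd a (indicator {y<..}) (Y t \<omega>))"
    using l1 l2 unfolding eq by (rule LIMSEQ_unique)
  also have "expectation (\<lambda>\<omega>. indicator {y<..} (Y t \<omega>) * of_bool (\<not> hit \<omega>) :: real)
     = expectation (indicator {\<omega>\<in>space M. \<not> hit \<omega> \<and> y < Y t \<omega>} :: _ \<Rightarrow> real)"
    by (intro Bochner_Integration.integral_cong) (auto simp: indicator_def)
  also have "\<dots> = prob {\<omega>\<in>space M. \<not> hit \<omega> \<and> y < Y t \<omega>}" by simp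
  finally show ?thesis by (simp add: hit_def Y_def not_le)
qed

end

text \<open>
  The part of \<open>P(X t > y, \<tau> > t)\<close>, for start in \<open>x\<close>, that is left when the factor \<open>exp (a * x - x\<^sup>2 / (2 * t))\<close> and
  factors depending on \<open>t\<close> only are split off from the transition density of the absorbed motion.
\<close>

definition tail_kernel :: "real \<Rightarrow> real \<Rightarrow> real \<Rightarrow> real \<Rightarrow> real" where
  "tail_kernel a t y x =
    (\<integral>z. exp (- a * z - z\<^sup>2 / (2 * t)) * sinh (x * z / t) * indicator {y<..} z \<partial>lborel)"

lemma borel_measurable_sinh [measurable (raw)]:
  fixes f :: "'a \<Rightarrow> real"
  assumes [measurable]: "f \<in> borel_measurable M"
  shows "(\<lambda>x. sinh (f x)) \<in> borel_measurable M"
  unfolding sinh_field_def by measurable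

lemma tail_kernel_measurable [measurable]: "tail_kernel a t y \<in> borel_measurable borel"
proof -
  have [measurable]: "(indicator {y<..} :: real \<Rightarrow> real) \<in> borel_measurable borel" by simp
  show ?thesis unfolding tail_kernel_def by measurable
qed

lemma normal_density_drift:
  assumes t: "0 < t"
  shows "normal_density (x - a * t) (sqrt t) z =
    exp (- a\<^sup>2 * t / 2) / sqrt (2 * pi * t) * exp (a * x - x\<^sup>2 / (2 * t)) *
      (exp (- a * z - z\<^sup>2 / (2 * t)) * exp (x * z / t))"
proof -
  have "- (z - (x - a * t))\<^sup>2 / (2 * t) = - a\<^sup>2 * t / 2 + (a * x - x\<^sup>2 / (2 * t)) +
      ((- a * z - z\<^sup>2 / (2 * t)) + x * z / t)"
    using t by (simp add: field_simps power2_eq_square)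
  then show ?thesis using t unfolding normal_density_def
    by (simp only: exp_add real_sqrt_pow2 less_imp_le) (simp add: mult_ac)
qed

text \<open>
  Completing the square in the density of \<open>x + B t - a * t\<close> at \<open>z\<close> and at the mirror point \<open>- z\<close> produces the terms
  \<open>exp (x * z / t)\<close> and \<open>exp (- x * z / t)\<close> with the same prefactor; their difference is the hyperbolic sine.
\<close>

lemma (in standard_brownian_motion) expectation_reflected:
  assumes t: "0 < t" and a: "0 \<le> a" and y: "0 \<le> y"
  shows "expectation (\<lambda>\<omega>. drift_odd a (indicator {y<..}) (x + B t \<omega> - a * t))
    = 2 * (exp (- a\<^sup>2 * t / 2) / sqrt (2 * pi * t)) * (exp (a * x - x\<^sup>2 / (2 * t)) * tail_kernel a t y x)"
proof -
  define I where "I = (indicator {y<..} :: real \<Rightarrow> real)"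
  have [measurable]: "I \<in> borel_measurable borel" by (simp add: I_def)
  let ?n = "normal_density (x - a * t) (sqrt t)"
  define F where "F = drift_odd a I"
  define C where "C = exp (- a\<^sup>2 * t / 2) / sqrt (2 * pi * t) * exp (a * x - x\<^sup>2 / (2 * t))"
  have [measurable]: "F \<in> borel_measurable borel" by (simp add: F_def)
  have pos: "0 < sqrt t" using t by simp
  \<comment> \<open>Since \<open>I (- z)\<close> vanishes for \<open>z \<ge> 0\<close>, the exponential can be bounded by \<open>1\<close>, which gives integrability.\<close>
  have e2: "exp (2 * a * z) * I (- z) = exp (2 * a * min z 0) * I (- z)" for z
    using y by (auto simp: I_def indicator_def min_def)
  have ni: "integrable lborel ?n" using pos by (rule integrable_normal_density)
  have i1: "integrable lborel (\<lambda>z. ?n z * I z)"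
    by (rule Bochner_Integration.integrable_bound[OF ni]) (auto simp: I_def indicator_def)
  have i2: "integrable lborel (\<lambda>z. ?n z * (exp (2 * a * z) * I (- z)))"
    unfolding e2
    by (rule Bochner_Integration.integrable_bound[OF ni])
      (use a in \<open>auto simp: I_def indicator_def abs_mult intro!: AE_I2 mult_left_le mult_nonneg_nonpos\<close>)
  have i2': "integrable lborel (\<lambda>z. ?n (- z) * (exp (- 2 * a * z) * I z))"
    using lborel_integrable_real_affine[OF i2, of "-1" 0] by simp
  have "expectation (\<lambda>\<omega>. F (x + B t \<omega> - a * t))
      = expectation (\<lambda>\<omega>. F (x + (B t \<omega> - B 0 \<omega>) - a * t))"
    by (intro Bochner_Integration.integral_cong) (auto simp: start_zero)
  also have "\<dots> = (\<integral>z. normal_density 0 (sqrt (t - 0)) z * F (x + z - a * t) \<partial>lborel)"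
    by (rule distributed_integral[OF normal_increments, symmetric]) (use t in auto)
  also have "\<dots> = (\<integral>z. ?n (x - a * t + z) * F (x - a * t + z) \<partial>lborel)"
    by (simp add: normal_density_def algebra_simps)
  also have "\<dots> = (\<integral>z. ?n z * F z \<partial>lborel)"
    using lborel_integral_real_affine[of 1 "\<lambda>z. ?n z * F z" "x - a * t"] by simp
  also have "\<dots> = (\<integral>z. ?n z * I z - ?n z * (exp (2 * a * z) * I (- z)) \<partial>lborel)"
    by (intro Bochner_Integration.integral_cong) (auto simp: F_def drift_odd_def algebra_simps)
  also have "\<dots> = (\<integral>z. ?n z * I z \<partial>lborel) - (\<integral>z. ?n z * (exp (2 * a * z) * I (- z)) \<partial>lborel)"
    by (rule Bochner_Integration.integral_diff[OF i1 i2])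
  also have "(\<integral>z. ?n z * (exp (2 * a * z) * I (- z)) \<partial>lborel)
     = (\<integral>z. ?n (- z) * (exp (- 2 * a * z) * I z) \<partial>lborel)"
    using lborel_integral_real_affine[of "-1" "\<lambda>z. ?n z * (exp (2 * a * z) * I (- z))" 0] by simp
  also have "(\<integral>z. ?n z * I z \<partial>lborel) - (\<integral>z. ?n (- z) * (exp (- 2 * a * z) * I z) \<partial>lborel)
     = (\<integral>z. ?n z * I z - ?n (- z) * (exp (- 2 * a * z) * I z) \<partial>lborel)"
    by (rule Bochner_Integration.integral_diff[OF i1 i2', symmetric])
  also have "\<dots> = (\<integral>z. 2 * C * (exp (- a * z - z\<^sup>2 / (2 * t)) * sinh (x * z / t) * I z) \<partial>lborel)"
  proof (intro Bochner_Integration.integral_cong refl)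
    fix z
    have "exp (a * z - z\<^sup>2 / (2 * t)) * exp (- 2 * a * z) = exp (- a * z - z\<^sup>2 / (2 * t))"
      unfolding exp_add[symmetric] by (simp add: algebra_simps)
    then have m: "?n (- z) * exp (- 2 * a * z) = C * (exp (- a * z - z\<^sup>2 / (2 * t)) * exp (- (x * z / t)))"
      unfolding normal_density_drift[OF t] C_def by (simp add: mult_ac)
    have p: "?n z = C * (exp (- a * z - z\<^sup>2 / (2 * t)) * exp (x * z / t))"
      unfolding normal_density_drift[OF t] C_def by (simp add: mult_ac)
    have "?n z * I z - ?n (- z) * (exp (- 2 * a * z) * I z) = (?n z - ?n (- z) * exp (- 2 * a * z)) * I z"
      by (simp add: algebra_simps)
    also have "\<dots> = 2 * C * (exp (- a * z - z\<^sup>2 / (2 * t)) * sinh (x * z / t) * I z)"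
      unfolding m p by (simp add: sinh_field_def algebra_simps)
    finally show "?n z * I z - ?n (- z) * (exp (- 2 * a * z) * I z)
       = 2 * C * (exp (- a * z - z\<^sup>2 / (2 * t)) * sinh (x * z / t) * I z)" .
  qed
  also have "\<dots> = 2 * C * tail_kernel a t y x"
    by (simp add: tail_kernel_def I_def)
  finally show ?thesis by (simp add: F_def I_def C_def mult_ac)
qed

lemma distr_pair_indep_set:
  assumes "prob_space M" and [measurable]: "V \<in> measurable M S" "W \<in> measurable M T"
    and ind: "prob_space.indep_set M (sets (vimage_algebra (space M) V S)) (sets (vimage_algebra (space M) W T))"
  shows "distr M S V \<Otimes>\<^sub>M distr M T W = distr M (S \<Otimes>\<^sub>M T) (\<lambda>\<omega>. (V \<omega>, W \<omega>))"
proof -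
  interpret prob_space M by fact
  interpret V: prob_space "distr M S V" by (rule prob_space_distr) fact
  interpret W: prob_space "distr M T W" by (rule prob_space_distr) fact
  show ?thesis
  proof (rule pair_measure_eqI)
    fix A B assume A: "A \<in> sets (distr M S V)" and B: "B \<in> sets (distr M T W)"
    then have [measurable]: "A \<in> sets S" "B \<in> sets T" by auto
    have a: "V -` A \<inter> space M \<in> sets (vimage_algebra (space M) V S)"
      "W -` B \<inter> space M \<in> sets (vimage_algebra (space M) W T)"
      by (auto intro: in_vimage_algebra)
    have "prob ((V -` A \<inter> space M) \<inter> (W -` B \<inter> space M)) = prob (V -` A \<inter> space M) * prob (W -` B \<inter> space M)"
      using ind a unfolding indep_sets2_eq by blast
    moreover have "(V -` A \<inter> space M) \<inter> (W -` B \<inter> space M) = (\<lambda>\<omega>. (V \<omega>, W \<omega>)) -` (A \<times> B) \<inter> space M" by auto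
    ultimately show "emeasure (distr M S V) A * emeasure (distr M T W) B
        = emeasure (distr M (S \<Otimes>\<^sub>M T) (\<lambda>\<omega>. (V \<omega>, W \<omega>))) (A \<times> B)"
      by (simp add: emeasure_distr emeasure_eq_measure ennreal_mult'')
  next
    show "sets (distr M S V \<Otimes>\<^sub>M distr M T W) = sets (distr M (S \<Otimes>\<^sub>M T) (\<lambda>\<omega>. (V \<omega>, W \<omega>)))"
      unfolding sets_distr by (intro sets_pair_measure_cong) auto
  qed unfold_locales
qed

context absorbed_drifted_brownian_motion
begin

text \<open>
  Absorption is defined through the zeros of \<open>X\<close>, survival is computed from the drifted path. Before the hitting time
  both paths agree, so the intermediate value theorem keeps the drifted path positive. Conversely, if
  the hitting time \<open>r\<close> were at most \<open>t\<close>, then at \<open>r\<close> the two descriptions of \<open>X\<close> would give \<open>0\<close> and a positive value.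
\<close>

lemma survives_iff:
  assumes w: "\<omega> \<in> space M" and t: "0 \<le> t"
  shows "ereal t < hitting_time_zero (\<lambda>s. X s \<omega>) \<longleftrightarrow> (\<forall>s\<in>{0..t}. 0 < X 0 \<omega> + B s \<omega> - \<alpha> * s)"
proof -
  let ?h = "hitting_time_zero (\<lambda>s. X s \<omega>)" and ?Y = "\<lambda>s. X 0 \<omega> + B s \<omega> - \<alpha> * s"
  have h_le: "?h \<le> ereal s" if "0 \<le> s" "X s \<omega> = 0" for s
    unfolding hitting_time_zero_def by (rule Inf_lower) (use that in auto)
  have h0: "0 \<le> ?h"
    unfolding hitting_time_zero_def by (rule Inf_greatest) auto
  show ?thesis
  proof
    assume surv: "ereal t < ?h"
    have eq: "X s \<omega> = ?Y s" if "s \<in> {0..t}" for s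
    proof (rule before_absorption[OF w])
      have "ereal s \<le> ereal t" using that by simp
      also have "\<dots> \<le> ?h" using surv by (rule less_imp_le)
      finally show "ereal s \<le> ?h" .
    qed (use that in simp)
    have nz: "?Y s \<noteq> 0" if "s \<in> {0..t}" for s
    proof
      assume "?Y s = 0"
      then have "X s \<omega> = 0" using eq[OF that] by (simp only:)
      then have "?h \<le> ereal s" using that by (intro h_le) auto
      also have "\<dots> \<le> ereal t" using that by simp
      finally show False using surv by simp
    qed
    show "\<forall>s\<in>{0..t}. 0 < ?Y s"
    proof (rule ccontr)
      assume "\<not> ?thesis"
      then obtain s where s: "s \<in> {0..t}" "?Y s \<le> 0" by (auto simp: not_less)
      have "continuous_on {0..s} ?Y" using continuous_paths[OF w] s
        by (intro continuous_intros) (auto elim: continuous_on_subset)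
      moreover have "0 \<le> ?Y 0" using initial_nonneg[OF w] start_zero[OF w] by simp
      ultimately obtain r where "r \<in> {0..s}" "?Y r = 0"
        using IVT2'[of ?Y s 0 0] s by auto
      then show False using nz[of r] s by auto
    qed
  next
    assume pos: "\<forall>s\<in>{0..t}. 0 < ?Y s"
    show "ereal t < ?h"
    proof (rule ccontr)
      assume "\<not> ?thesis"
      then have le: "?h \<le> ereal t" by simp
      then obtain r where r: "?h = ereal r" using h0 by (cases ?h) auto
      then have "r \<in> {0..t}" using h0 le by auto
      moreover from this have "X r \<omega> = ?Y r" "X r \<omega> = 0"
        using r by (auto intro!: before_absorption after_absorption w)
      moreover have "0 < ?Y r" using pos \<open>r \<in> {0..t}\<close> by blast
      ultimately show False by linarith
    qed
  qed
qed

lemma survival_event_eq: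
  assumes "0 \<le> t"
  shows "survival_event M X t = {\<omega>\<in>space M. \<forall>s\<in>{0..t}. 0 < X 0 \<omega> + B s \<omega> - \<alpha> * s}"
  using survives_iff[OF _ assms] unfolding survival_event_def by blast

lemma X_eq:
  assumes "\<omega> \<in> space M" "0 \<le> t"
  shows "X t \<omega> = (if \<omega> \<in> survival_event M X t then X 0 \<omega> + B t \<omega> - \<alpha> * t else 0)"
  using assms before_absorption[OF assms] after_absorption[OF assms]
  by (auto simp: survival_event_def not_less)

lemma survival_event_measurable [measurable]:
  assumes t: "0 < t"
  shows "survival_event M X t \<in> sets M"
proof -
  have [measurable]: "B (t * real j / 2^n) \<in> borel_measurable M" "X 0 \<in> borel_measurable M" for j n
    using t initial_random_variable by (auto intro: random_variable)
  have cont: "continuous_on {0..t} (\<lambda>s. X 0 \<omega> + B s \<omega> - \<alpha> * s)" if "\<omega> \<in> space M" for \<omega>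
    using continuous_paths[OF that]
    by (intro continuous_intros) (auto elim: continuous_on_subset)
  have "survival_event M X t = {\<omega>\<in>space M. \<not> (\<exists>s\<in>{0..t}. X 0 \<omega> + B s \<omega> - \<alpha> * s \<le> 0)}"
    using t by (auto simp: survival_event_eq not_le)
  also have "\<dots> = {\<omega>\<in>space M. \<not> (\<forall>m. \<exists>n. \<exists>j\<le>(2::nat)^n.
      X 0 \<omega> + B (t * real j / 2^n) \<omega> - \<alpha> * (t * real j / 2^n) \<le> 1 / real (Suc m))}"
    using path_hits_iff[OF t cont] by blast
  also have "\<dots> \<in> sets M"
    by measurable
  finally show ?thesis .
qed

lemma X_measurable:
  assumes t: "0 < t"
  shows "X t \<in> borel_measurable M"
proof -
  have [measurable]: "B t \<in> borel_measurable M" "X 0 \<in> borel_measurable M" "survival_event M X t \<in> sets M"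
    using t initial_random_variable by (auto intro: random_variable survival_event_measurable)
  have "(\<lambda>\<omega>. if \<omega> \<in> survival_event M X t then X 0 \<omega> + B t \<omega> - \<alpha> * t else 0) \<in> borel_measurable M"
    by measurable
  then show ?thesis
    by (rule measurable_cong[THEN iffD1, rotated]) (use t X_eq[of _ t] in simp)
qed

text \<open>
  The joint event is a measurable function of the starting point and of the Brownian path restricted to \<open>[0, \<infinity>)\<close>,
  which are independent; conditionally on the starting point the reflection formula applies.
\<close>

lemma survival_tail:
  assumes a: "0 \<le> \<alpha>" and t: "0 < t" and y: "0 \<le> y"
  shows "prob {\<omega> \<in> survival_event M X t. y < X t \<omega>}
    = 2 * (exp (- \<alpha>\<^sup>2 * t / 2) / sqrt (2 * pi * t)) *
      (\<integral>x. exp (\<alpha> * x - x\<^sup>2 / (2 * t)) * tail_kernel \<alpha> t y x \<partial>distr M borel (X 0))"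
proof -
  define T where "T = (\<Pi>\<^sub>M t\<in>{0::real..}. (borel :: real measure))"
  define W where "W \<omega> = (\<lambda>s\<in>{0..}. B s \<omega>)" for \<omega>
  have X0 [measurable]: "X 0 \<in> borel_measurable M" by (rule initial_random_variable)
  have W: "W \<in> measurable M T"
    unfolding W_def T_def by (rule measurable_restrict) (auto intro: random_variable)
  have law: "distr M borel (X 0) \<Otimes>\<^sub>M distr M T W = distr M (borel \<Otimes>\<^sub>M T) (\<lambda>\<omega>. (X 0 \<omega>, W \<omega>))"
    using distr_pair_indep_set[OF prob_space_axioms X0 W] initial_indep unfolding W_def T_def .
  define surv where "surv x b \<longleftrightarrow> \<not> (\<forall>m. \<exists>n. \<exists>j\<le>(2::nat)^n.
      x + b (t * real j / 2^n) - \<alpha> * (t * real j / 2^n) \<le> 1 / real (Suc m)) \<and> y < x + b t - \<alpha> * t"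
    for x and b :: "real \<Rightarrow> real"
  define Y where "Y x s \<omega> = x + B s \<omega> - \<alpha> * s" for x s \<omega>
  have surv: "surv x (W \<omega>) \<longleftrightarrow> (\<forall>s\<in>{0..t}. 0 < Y x s \<omega>) \<and> y < Y x t \<omega>" if w: "\<omega> \<in> space M" for x \<omega>
  proof -
    have cont: "continuous_on {0..t} (\<lambda>s. Y x s \<omega>)"
      unfolding Y_def using continuous_paths[OF w]
      by (intro continuous_intros) (auto elim: continuous_on_subset)
    have "W \<omega> (t * real j / 2^n) = B (t * real j / 2^n) \<omega>" "W \<omega> t = B t \<omega>" for j n
      using t by (auto simp: W_def)
    then show ?thesis
      using path_hits_iff[OF t cont] unfolding surv_def Y_def by (simp only: not_le[symmetric]) blast
  qed
  have mb [measurable]: "(\<lambda>b. b s) \<in> borel_measurable T" if "0 \<le> s" for s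
    unfolding T_def by (rule measurable_component_singleton) (use that in simp)
  have mp: "(\<lambda>p. snd p s) \<in> borel_measurable (borel \<Otimes>\<^sub>M T)" if "0 \<le> s" for s
    by (rule measurable_compose[OF measurable_snd mb[OF that]])
  have [measurable]: "(\<lambda>p. snd p (t * real j / 2^n)) \<in> borel_measurable (borel \<Otimes>\<^sub>M T)"
    "(\<lambda>p. snd p t) \<in> borel_measurable (borel \<Otimes>\<^sub>M T)" for j n
    using t by (auto intro!: mp)
  have "Measurable.pred (borel \<Otimes>\<^sub>M T) (\<lambda>p. surv (fst p) (snd p))"
    unfolding surv_def by measurable
  then have meas: "(\<lambda>(x, b). of_bool (surv x b) :: real) \<in> borel_measurable (borel \<Otimes>\<^sub>M T)"
    unfolding case_prod_beta by measurable
  have Xt: "{\<omega> \<in> survival_event M X t. y < X t \<omega>} = {\<omega>\<in>space M. surv (X 0 \<omega>) (W \<omega>)}"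
    using t X_eq[of _ t] by (auto simp: surv Y_def survival_event_eq)
  have sets: "{\<omega> \<in> survival_event M X t. y < X t \<omega>} \<in> sets M"
    using survival_event_measurable[OF t] X_measurable[OF t] by measurable
  have "prob {\<omega> \<in> survival_event M X t. y < X t \<omega>}
     = expectation (indicator {\<omega>\<in>space M. surv (X 0 \<omega>) (W \<omega>)} :: _ \<Rightarrow> real)"
    using sets unfolding Xt by simp
  also have "\<dots> = expectation (\<lambda>\<omega>. of_bool (surv (X 0 \<omega>) (W \<omega>)))"
    by (intro Bochner_Integration.integral_cong) (auto simp: indicator_def)
  also have "\<dots> = (\<integral>x. expectation (\<lambda>\<omega>. of_bool (surv x (W \<omega>))) \<partial>distr M borel (X 0))"
    by (rule product_law_expectation[OF X0 W law meas, where C=1]) (auto simp: of_bool_def)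
  also have "\<dots> = (\<integral>x. 2 * (exp (- \<alpha>\<^sup>2 * t / 2) / sqrt (2 * pi * t)) *
      (exp (\<alpha> * x - x\<^sup>2 / (2 * t)) * tail_kernel \<alpha> t y x) \<partial>distr M borel (X 0))"
  proof (rule integral_cong_AE)
    have eq: "expectation (\<lambda>\<omega>. of_bool (surv x (W \<omega>))) = 2 * (exp (- \<alpha>\<^sup>2 * t / 2) / sqrt (2 * pi * t)) *
      (exp (\<alpha> * x - x\<^sup>2 / (2 * t)) * tail_kernel \<alpha> t y x)" if x: "0 \<le> x" for x
    proof -
      have [measurable]: "B t \<in> borel_measurable M" using t by (intro random_variable) simp
      have "{\<omega>\<in>space M. (\<forall>s\<in>{0..t}. 0 < Y x s \<omega>) \<and> y < Y x t \<omega>}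
         = {\<omega>\<in>space M. \<not> (\<exists>s\<in>{0..t}. x + B s \<omega> - \<alpha> * s \<le> 0) \<and> y < x + B t \<omega> - \<alpha> * t}"
        by (auto simp: Y_def not_le)
      also have "\<dots> \<in> sets M" using pred_hits[OF t, of x \<alpha>] by measurable
      finally have "expectation (indicator {\<omega>\<in>space M. (\<forall>s\<in>{0..t}. 0 < Y x s \<omega>) \<and> y < Y x t \<omega>} :: _ \<Rightarrow> real)
         = prob {\<omega>\<in>space M. (\<forall>s\<in>{0..t}. 0 < Y x s \<omega>) \<and> y < Y x t \<omega>}" by simp
      moreover have "expectation (\<lambda>\<omega>. of_bool (surv x (W \<omega>)))
         = expectation (indicator {\<omega>\<in>space M. (\<forall>s\<in>{0..t}. 0 < Y x s \<omega>) \<and> y < Y x t \<omega>} :: _ \<Rightarrow> real)"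
        by (intro Bochner_Integration.integral_cong) (auto simp: surv indicator_def)
      ultimately show ?thesis
        unfolding expectation_reflected[OF t a y, symmetric] survival_reflection[OF t a x y, symmetric] Y_def
        by simp
    qed
    have "AE x in distr M borel (X 0). 0 \<le> x"
      by (subst AE_distr_iff) (auto intro!: initial_nonneg)
    then show "AE x in distr M borel (X 0). expectation (\<lambda>\<omega>. of_bool (surv x (W \<omega>)))
      = 2 * (exp (- \<alpha>\<^sup>2 * t / 2) / sqrt (2 * pi * t)) *
      (exp (\<alpha> * x - x\<^sup>2 / (2 * t)) * tail_kernel \<alpha> t y x)"
      by (rule AE_mp) (simp add: eq)
    show "(\<lambda>x. expectation (\<lambda>\<omega>. of_bool (surv x (W \<omega>)) :: real)) \<in> borel_measurable (distr M borel (X 0))"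
    proof -
      interpret W: prob_space "distr M T W" by (rule prob_space_distr) fact
      have sets': "sets (borel \<Otimes>\<^sub>M distr M T W) = sets ((borel :: real measure) \<Otimes>\<^sub>M T)"
        by (intro sets_pair_measure_cong) auto
      have "(\<lambda>x. \<integral>b. (of_bool (surv x b) :: real) \<partial>distr M T W) \<in> borel_measurable (borel :: real measure)"
        by (rule W.borel_measurable_lebesgue_integral)
          (use meas in \<open>simp add: measurable_cong_sets[OF sets' refl]\<close>)
      moreover have "(\<integral>b. (of_bool (surv x b) :: real) \<partial>distr M T W) = expectation (\<lambda>\<omega>. of_bool (surv x (W \<omega>)))" for x
        using measurable_Pair2[OF meas, of x] by (intro integral_distr W) auto
      ultimately show ?thesis by simp
    qed
  qed simp
  also have "\<dots> = 2 * (exp (- \<alpha>\<^sup>2 * t / 2) / sqrt (2 * pi * t)) *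
      (\<integral>x. exp (\<alpha> * x - x\<^sup>2 / (2 * t)) * tail_kernel \<alpha> t y x \<partial>distr M borel (X 0))"
    by simp
  finally show ?thesis .
qed

end

section \<open>Exponential moments of the initial law\<close>

text \<open>
  For \<open>\<gamma>\<close> between \<open>\<beta>\<close> and \<open>\<alpha>\<close> the tail of \<open>\<mu>\<close> is eventually at most \<open>exp (- \<gamma> * x)\<close>. Bounding \<open>exp (\<beta> * x)\<close> on
  \<open>[n, n + 1)\<close> by its value at the right end point leaves a convergent geometric series.
\<close>

lemma exp_moment_of_tail_rate:
  assumes \<mu>: "real_distribution \<mu>" and supp: "measure \<mu> {0..} = 1"
    and rate: "ereal \<alpha> \<le> tail_rate \<mu>" and \<beta>: "0 \<le> \<beta>" "\<beta> < \<alpha>"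
  shows "integrable \<mu> (\<lambda>x. exp (\<beta> * x))"
proof -
  interpret real_distribution \<mu> by fact
  define \<gamma> where "\<gamma> = (\<alpha> + \<beta>) / 2"
  have \<gamma>: "\<beta> < \<gamma>" "\<gamma> < \<alpha>" using \<beta> by (auto simp: \<gamma>_def)
  have "eventually (\<lambda>x::real. ereal \<gamma> < (- ln_ext (measure \<mu> {x..})) / ereal x) at_top"
    using rate \<gamma>(2) unfolding tail_rate_def le_Liminf_iff by simp
  then have "eventually (\<lambda>x. measure \<mu> {x..} \<le> exp (- \<gamma> * x)) at_top"
    using eventually_gt_at_top[of 0]
  proof eventually_elim
    case (elim x)
    show ?case
    proof (cases "measure \<mu> {x..} = 0")
      case False
      then have pos: "0 < measure \<mu> {x..}" using measure_nonneg[of \<mu> "{x..}"] by linarith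
      with elim False have "\<gamma> < - ln (measure \<mu> {x..}) / x" by (simp add: ln_ext_def)
      then have "ln (measure \<mu> {x..}) \<le> - \<gamma> * x" using elim(2) by (simp add: field_simps)
      then show ?thesis using pos by (metis exp_le_cancel_iff exp_ln)
    qed simp
  qed
  then obtain N where N: "\<And>x. x \<ge> N \<Longrightarrow> measure \<mu> {x..} \<le> exp (- \<gamma> * x)"
    by (auto simp: eventually_at_top_linorder)
  define g where "g n = exp (\<beta> * (real n + 1)) * measure \<mu> {real n..}" for n
  have g0: "0 \<le> g n" for n by (simp add: g_def)
  have "summable g"
  proof (rule summable_comparison_test_ev)
    show "eventually (\<lambda>n. norm (g n) \<le> exp \<beta> * exp (- (\<gamma> - \<beta>)) ^ n) sequentially"
    proof (intro eventually_sequentiallyI[of "nat \<lceil>N\<rceil>"])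
      fix n assume "nat \<lceil>N\<rceil> \<le> n"
      then have "N \<le> real n" by linarith
      then have "g n \<le> exp (\<beta> * (real n + 1)) * exp (- \<gamma> * real n)"
        unfolding g_def by (intro mult_left_mono N) auto
      also have "\<dots> = exp \<beta> * exp (- (\<gamma> - \<beta>)) ^ n"
        by (simp add: exp_of_nat_mult[symmetric] exp_add[symmetric] algebra_simps)
      finally show "norm (g n) \<le> exp \<beta> * exp (- (\<gamma> - \<beta>)) ^ n" using g0[of n] by simp
    qed
    show "summable (\<lambda>n. exp \<beta> * exp (- (\<gamma> - \<beta>)) ^ n)"
      using \<gamma> by (intro summable_mult summable_geometric) simp
  qed
  have AE0: "AE x in \<mu>. 0 \<le> x"
    using supp by (subst (asm) prob_eq_1) auto
  have "(\<integral>\<^sup>+x. ennreal (exp (\<beta> * x)) \<partial>\<mu>)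
     \<le> (\<integral>\<^sup>+x. (\<Sum>n. ennreal (exp (\<beta> * (real n + 1))) * indicator {real n..} x) \<partial>\<mu>)"
  proof (rule nn_integral_mono_AE, use AE0 in eventually_elim)
    fix x :: real assume x: "0 \<le> x"
    define n where "n = nat \<lfloor>x\<rfloor>"
    have n: "real n \<le> x" "x \<le> real n + 1" using x unfolding n_def by linarith+
    have "ennreal (exp (\<beta> * x)) \<le> ennreal (exp (\<beta> * (real n + 1))) * indicator {real n..} x"
      using n \<beta> by (auto intro!: ennreal_leI mult_left_mono)
    also have "\<dots> \<le> (\<Sum>n. ennreal (exp (\<beta> * (real n + 1))) * indicator {real n..} x)" (is "?f n \<le> _")
    proof -
      have "(\<Sum>i\<in>{n}. ?f i) \<le> suminf ?f" by (rule sum_le_suminf) auto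
      then show ?thesis by (simp only: sum.insert sum.empty finite.emptyI empty_iff not_False_eq_True add_0_right)
    qed
    finally show "ennreal (exp (\<beta> * x)) \<le> (\<Sum>n. ennreal (exp (\<beta> * (real n + 1))) * indicator {real n..} x)" .
  qed
  also have "\<dots> = (\<Sum>n. \<integral>\<^sup>+x. ennreal (exp (\<beta> * (real n + 1))) * indicator {real n..} x \<partial>\<mu>)"
    by (rule nn_integral_suminf) auto
  also have "\<dots> = (\<Sum>n. ennreal (g n))"
    by (intro suminf_cong, subst nn_integral_cmult_indicator)
      (auto simp: g_def emeasure_eq_measure ennreal_mult'')
  also have "\<dots> = ennreal (suminf g)"
    using g0 \<open>summable g\<close> by (rule suminf_ennreal2)
  finally show ?thesis
    by (intro integrableI_bounded) (auto simp: less_top[symmetric] top_unique intro: le_less_trans)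
qed

section \<open>Estimates for the kernel\<close>

text \<open>
  The value of \<open>\<integral>\<^bsub>z>y\<^esub> z * exp (- b * z) dz\<close>.
\<close>

definition gamma_tail :: "real \<Rightarrow> real \<Rightarrow> real" where
  "gamma_tail b y = (1 + b * y) / b\<^sup>2 * exp (- b * y)"

lemma gamma_tail_nn:
  assumes b: "0 < b" and y: "0 \<le> y"
  shows "(\<integral>\<^sup>+z. ennreal (z * exp (- b * z) * indicator {y<..} z) \<partial>lborel) = ennreal (gamma_tail b y)"
proof -
  have "(\<integral>\<^sup>+z. ennreal (z * exp (- b * z) * indicator {y<..} z) \<partial>lborel)
      = (\<integral>\<^sup>+z. ennreal (z * exp (- b * z)) * indicator {y..} z \<partial>lborel)"
    using AE_lborel_singleton[of y]
    by (intro nn_integral_cong_AE, eventually_elim) (auto simp: indicator_def)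
  also have "\<dots> = ennreal (0 - (- gamma_tail b y))"
  proof (rule nn_integral_FTC_atLeast)
    show "DERIV (\<lambda>z. - gamma_tail b z) z :> z * exp (- b * z)" for z
      unfolding gamma_tail_def
      by (rule derivative_eq_intros refl | use b in \<open>simp add: field_simps power2_eq_square\<close>)+
    show "((\<lambda>z. - gamma_tail b z) \<longlongrightarrow> 0) at_top"
      unfolding gamma_tail_def using b by real_asymp
  qed (use y in auto)
  finally show ?thesis by simp
qed

lemma gamma_tail_integral:
  assumes b: "0 < b" and y: "0 \<le> y"
  shows "integrable lborel (\<lambda>z. z * exp (- b * z) * indicator {y<..} z)"
    and "(\<integral>z. z * exp (- b * z) * indicator {y<..} z \<partial>lborel) = gamma_tail b y"
proof -
  have pos: "0 \<le> gamma_tail b y" using assms by (simp add: gamma_tail_def)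
  have "has_bochner_integral lborel (\<lambda>z. z * exp (- b * z) * indicator {y<..} z) (gamma_tail b y)"
    by (rule has_bochner_integral_nn_integral)
      (use y pos gamma_tail_nn[OF assms] in \<open>auto simp: indicator_def intro!: AE_I2\<close>)
  then show "integrable lborel (\<lambda>z. z * exp (- b * z) * indicator {y<..} z)"
    "(\<integral>z. z * exp (- b * z) * indicator {y<..} z \<partial>lborel) = gamma_tail b y"
    by (auto simp: has_bochner_integral_iff)
qed

lemma exp_tail_integrable:
  fixes b :: real
  assumes b: "0 < b"
  shows "integrable lborel (\<lambda>z. exp (- b * z) * indicator {0<..} z)"
proof (rule Bochner_Integration.integrable_bound)
  show "integrable lborel (\<lambda>z. exp b * (indicator {0..1} z) + z * exp (- b * z) * indicator {0<..} z)"
    using gamma_tail_integral(1)[OF b, of 0] by (intro Bochner_Integration.integrable_add) auto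
  have "exp (- b * z) * indicator {0<..} z \<le> exp b * (indicator {0..1} z) + z * exp (- b * z) * indicator {0<..} z" for z
  proof (cases "z \<le> 1")
    case True
    show ?thesis
    proof (cases "0 < z")
      case z: True
      have "- b * z \<le> b" using mult_pos_pos[OF b z] b by simp
      then have "exp (- b * z) \<le> exp b" by (simp only: exp_le_cancel_iff)
      then have "exp (- b * z) \<le> exp b + z * exp (- b * z)"
        by (rule order.trans) (use z in simp)
      then show ?thesis using z True by (simp add: indicator_def)
    qed simp
  next
    case False
    then have "1 * exp (- b * z) \<le> z * exp (- b * z)" by (intro mult_right_mono) auto
    then show ?thesis using False by simp
  qed
  then show "AE z in lborel. norm (exp (- b * z) * indicator {0<..} z)
    \<le> norm (exp b * (indicator {0..1} z) + z * exp (- b * z) * indicator {0<..} z)"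
    by (intro AE_I2) (auto intro!: order.trans[OF _ abs_ge_self])
qed auto

lemma sinh_ge_self: "0 \<le> u \<Longrightarrow> u \<le> sinh (u::real)"
proof -
  assume u: "0 \<le> u"
  have "sinh 0 - 0 \<le> sinh u - u"
  proof (rule DERIV_nonneg_imp_nondecreasing[OF u])
    fix v :: real
    have "((\<lambda>v. sinh v - v) has_real_derivative cosh v - 1) (at v)"
      by (auto intro!: derivative_eq_intros)
    then show "\<exists>d. ((\<lambda>v. sinh v - v) has_real_derivative d) (at v) \<and> 0 \<le> d"
      using cosh_real_ge_1[of v] by (intro exI[of _ "cosh v - 1"]) auto
  qed
  then show ?thesis by simp
qed

lemma sinh_le_mult_exp: "0 \<le> u \<Longrightarrow> sinh u \<le> u * exp (u::real)"
proof -
  have "exp u * (1 - exp (- 2 * u)) \<le> exp u * (2 * u)"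
    by (rule mult_left_mono) (use exp_ge_add_one_self[of "- 2 * u"] in linarith, simp)
  moreover have "exp u * (1 - exp (- 2 * u)) = 2 * sinh u"
    by (simp add: sinh_field_def algebra_simps flip: exp_add)
  moreover have "exp u * (2 * u) = 2 * (u * exp u)" by simp
  ultimately show ?thesis by linarith
qed

lemma sinh_le_exp: "sinh u \<le> exp (u::real)"
proof -
  have "sinh u \<le> (exp u - 0) / 2"
    unfolding sinh_field_def by (intro divide_right_mono diff_left_mono) auto
  then show ?thesis by (rule order.trans) simp
qed

text \<open>
  With \<open>d = x - z\<close> the exponent on the left is at most \<open>\<alpha> * d - d\<^sup>2 / (2 * t)\<close>, and \<open>\<theta> * d - d\<^sup>2 / (2 * t) \<le> \<theta>\<^sup>2 * t / 2\<close>
  because \<open>(d - \<theta> * t)\<^sup>2 \<ge> 0\<close>. So part of the rate \<open>\<alpha>\<close> can be traded for an exponential in \<open>t\<close>.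
\<close>

lemma gauss_tilt_bound:
  fixes t :: real
  assumes t: "0 < t"
  shows "exp (\<alpha> * x - x\<^sup>2 / (2 * t)) * (exp (- \<alpha> * z - z\<^sup>2 / (2 * t)) * sinh (x * z / t))
    \<le> exp ((\<alpha> - \<theta>) * x + \<theta>\<^sup>2 * t / 2) * exp (- (\<alpha> - \<theta>) * z)"
proof -
  have "exp (\<alpha> * x - x\<^sup>2 / (2 * t)) * (exp (- \<alpha> * z - z\<^sup>2 / (2 * t)) * sinh (x * z / t))
     \<le> exp (\<alpha> * x - x\<^sup>2 / (2 * t)) * (exp (- \<alpha> * z - z\<^sup>2 / (2 * t)) * exp (x * z / t))"
    by (intro mult_left_mono sinh_le_exp) auto
  also have "\<dots> = exp (\<alpha> * x - x\<^sup>2 / (2 * t) + (- \<alpha> * z - z\<^sup>2 / (2 * t) + x * z / t))"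
    by (simp add: exp_add)
  also have "\<dots> \<le> exp ((\<alpha> - \<theta>) * x + \<theta>\<^sup>2 * t / 2 + - (\<alpha> - \<theta>) * z)"
  proof -
    have "0 \<le> (x - z - \<theta> * t)\<^sup>2 / (2 * t)" using t by simp
    also have "\<dots> = ((\<alpha> - \<theta>) * x + \<theta>\<^sup>2 * t / 2 + - (\<alpha> - \<theta>) * z) -
       (\<alpha> * x - x\<^sup>2 / (2 * t) + (- \<alpha> * z - z\<^sup>2 / (2 * t) + x * z / t))"
      using t by (simp add: field_simps power2_eq_square)
    finally show ?thesis by simp
  qed
  also have "\<dots> = exp ((\<alpha> - \<theta>) * x + \<theta>\<^sup>2 * t / 2) * exp (- (\<alpha> - \<theta>) * z)"
    by (simp add: exp_add)
  finally show ?thesis .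
qed

lemma weighted_kernel_bound:
  assumes t: "0 < t" and y: "0 \<le> y" and x: "0 \<le> x" and \<theta>: "\<theta> < \<alpha>"
  shows "exp (\<alpha> * x - x\<^sup>2 / (2 * t)) * tail_kernel \<alpha> t y x
     \<le> exp ((\<alpha> - \<theta>) * x + \<theta>\<^sup>2 * t / 2) * (\<integral>z. exp (- (\<alpha> - \<theta>) * z) * indicator {0<..} z \<partial>lborel)" (is ?le)
    and "integrable lborel (\<lambda>z. exp (- \<alpha> * z - z\<^sup>2 / (2 * t)) * sinh (x * z / t) * indicator {y<..} z)" (is ?int)
proof -
  let ?w = "exp (\<alpha> * x - x\<^sup>2 / (2 * t))"
  let ?c = "exp ((\<alpha> - \<theta>) * x + \<theta>\<^sup>2 * t / 2)"
  let ?f = "\<lambda>z. exp (- \<alpha> * z - z\<^sup>2 / (2 * t)) * sinh (x * z / t) * indicator {y<..} z"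
  have up: "integrable lborel (\<lambda>z. ?c * (exp (- (\<alpha> - \<theta>) * z) * indicator {0<..} z))"
    using exp_tail_integrable[of "\<alpha> - \<theta>"] \<theta> by (intro integrable_mult_right) simp
  have f0: "0 \<le> ?f z" for z
    using x y t by (auto simp: indicator_def intro!: mult_nonneg_nonneg divide_nonneg_pos)
  have le: "?w * ?f z \<le> ?c * (exp (- (\<alpha> - \<theta>) * z) * indicator {0<..} z)" for z
    using gauss_tilt_bound[OF t, of \<alpha> x z \<theta>] y by (auto simp: indicator_def mult_ac)
  have w0: "0 \<le> ?w * ?f z" for z by (intro mult_nonneg_nonneg exp_ge_zero f0)
  have "norm (?w * ?f z) \<le> norm (?c * (exp (- (\<alpha> - \<theta>) * z) * indicator {0<..} z))" for z
    unfolding real_norm_def using le[of z] w0[of z] by linarith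
  then have "integrable lborel (\<lambda>z. ?w * ?f z)"
    by (intro Bochner_Integration.integrable_bound[OF up] AE_I2) measurable
  then show ?int by simp
  have "?w * tail_kernel \<alpha> t y x = (\<integral>z. ?w * ?f z \<partial>lborel)"
    by (simp add: tail_kernel_def)
  also have "\<dots> \<le> (\<integral>z. ?c * (exp (- (\<alpha> - \<theta>) * z) * indicator {0<..} z) \<partial>lborel)"
    by (rule integral_mono'[OF up le]) auto
  finally show ?le by simp
qed

text \<open>
  The inner integral with \<open>sinh u\<close> replaced by its lower bound \<open>u\<close>, divided by \<open>x / t\<close>.
\<close>

definition lower_tail :: "real \<Rightarrow> real \<Rightarrow> real \<Rightarrow> real" where
  "lower_tail \<alpha> y t = (\<integral>z. z * exp (- \<alpha> * z - z\<^sup>2 / (2 * t)) * indicator {y<..} z \<partial>lborel)"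

lemma lower_tail_tendsto:
  assumes a: "0 < \<alpha>" and y: "0 \<le> y"
  shows "(lower_tail \<alpha> y \<longlongrightarrow> gamma_tail \<alpha> y) at_top"
  unfolding lower_tail_def gamma_tail_integral(2)[OF a y, symmetric]
proof (rule integral_dominated_convergence_at_top)
  show "integrable lborel (\<lambda>z. z * exp (- \<alpha> * z) * indicator {y<..} z)"
    by (rule gamma_tail_integral(1)[OF a y])
  show "eventually (\<lambda>t. AE z in lborel. norm (z * exp (- \<alpha> * z - z\<^sup>2 / (2 * t)) * indicator {y<..} z)
     \<le> z * exp (- \<alpha> * z) * indicator {y<..} z) at_top"
    using eventually_gt_at_top[of 0]
    by eventually_elim (use y in \<open>auto simp: indicator_def intro!: AE_I2 mult_left_mono\<close>)
  have "((\<lambda>t. exp (- \<alpha> * z - z\<^sup>2 / (2 * t))) \<longlongrightarrow> exp (- \<alpha> * z)) at_top" for z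
    by real_asymp
  then show "AE z in lborel. ((\<lambda>t. z * exp (- \<alpha> * z - z\<^sup>2 / (2 * t)) * indicator {y<..} z)
     \<longlongrightarrow> z * exp (- \<alpha> * z) * indicator {y<..} z) at_top"
    by (intro AE_I2 tendsto_mult tendsto_const)
qed auto

lemma tail_kernel_lower:
  assumes a: "0 < \<alpha>" and t: "0 < t" and y: "0 \<le> y" and x: "0 \<le> x"
  shows "x / t * lower_tail \<alpha> y t \<le> tail_kernel \<alpha> t y x"
proof -
  have "x / t * lower_tail \<alpha> y t
      = (\<integral>z. x / t * (z * exp (- \<alpha> * z - z\<^sup>2 / (2 * t)) * indicator {y<..} z) \<partial>lborel)"
    by (simp add: lower_tail_def)
  also have "\<dots> \<le> tail_kernel \<alpha> t y x"
    unfolding tail_kernel_def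
  proof (rule integral_mono'[OF weighted_kernel_bound(2)[OF t y x a]])
    fix z
    show "x / t * (z * exp (- \<alpha> * z - z\<^sup>2 / (2 * t)) * indicator {y<..} z)
      \<le> exp (- \<alpha> * z - z\<^sup>2 / (2 * t)) * sinh (x * z / t) * indicator {y<..} z"
    proof (cases "y < z")
      case True
      have "exp (- \<alpha> * z - z\<^sup>2 / (2 * t)) * (x * z / t) \<le> exp (- \<alpha> * z - z\<^sup>2 / (2 * t)) * sinh (x * z / t)"
        using x y t True by (intro mult_left_mono sinh_ge_self) auto
      then show ?thesis using True by (simp add: mult_ac)
    qed simp
    show "0 \<le> exp (- \<alpha> * z - z\<^sup>2 / (2 * t)) * sinh (x * z / t) * indicator {y<..} z"
      using x y t by (auto simp: indicator_def intro!: mult_nonneg_nonneg divide_nonneg_pos)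
  qed
  finally show ?thesis .
qed

text \<open>
  Here \<open>sinh u \<le> u * exp u\<close> is used with \<open>u = x * z / t \<le> \<epsilon> * z\<close>: the extra exponential only lowers the decay
  rate from \<open>\<alpha>\<close> to \<open>\<alpha> - \<epsilon>\<close>.
\<close>

lemma tail_kernel_upper:
  assumes t: "0 < t" and y: "0 \<le> y" and x: "0 \<le> x" "x \<le> \<epsilon> * t" and \<epsilon>: "\<epsilon> < \<alpha>"
  shows "tail_kernel \<alpha> t y x \<le> x / t * gamma_tail (\<alpha> - \<epsilon>) y"
proof -
  have b: "0 < \<alpha> - \<epsilon>" using \<epsilon> by simp
  have "tail_kernel \<alpha> t y x \<le> (\<integral>z. x / t * (z * exp (- (\<alpha> - \<epsilon>) * z) * indicator {y<..} z) \<partial>lborel)"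
    unfolding tail_kernel_def
  proof (rule integral_mono')
    show "integrable lborel (\<lambda>z. x / t * (z * exp (- (\<alpha> - \<epsilon>) * z) * indicator {y<..} z))"
      by (intro integrable_mult_right gamma_tail_integral(1)[OF b y])
    fix z :: real
    show "0 \<le> x / t * (z * exp (- (\<alpha> - \<epsilon>) * z) * indicator {y<..} z)"
      using x y t by (auto simp: indicator_def)
    show "exp (- \<alpha> * z - z\<^sup>2 / (2 * t)) * sinh (x * z / t) * indicator {y<..} z
      \<le> x / t * (z * exp (- (\<alpha> - \<epsilon>) * z) * indicator {y<..} z)"
    proof (cases "y < z")
      case True
      then have z: "0 \<le> z" using y by simp
      have xt: "x / t \<le> \<epsilon>" using x t by (simp add: field_simps)
      have "exp (- \<alpha> * z - z\<^sup>2 / (2 * t)) * sinh (x * z / t) \<le> exp (- \<alpha> * z) * (x * z / t * exp (x * z / t))"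
        using x t z by (intro mult_mono sinh_le_mult_exp) auto
      also have "\<dots> \<le> exp (- \<alpha> * z) * (x * z / t * exp (\<epsilon> * z))"
        using x t z mult_right_mono[OF xt z] by (intro mult_left_mono) auto
      also have "\<dots> = x / t * (z * exp (- (\<alpha> - \<epsilon>) * z))"
      proof -
        have "exp (- (\<alpha> - \<epsilon>) * z) = exp (- \<alpha> * z) * exp (\<epsilon> * z)"
          by (simp add: algebra_simps flip: exp_add)
        then show ?thesis by simp
      qed
      finally show ?thesis using True by simp
    qed simp
  qed
  also have "\<dots> = x / t * gamma_tail (\<alpha> - \<epsilon>) y"
    using gamma_tail_integral(2)[OF b y] by simp
  finally show ?thesis .
qed

section \<open>Asymptotics of the survival integral\<close>

text \<open>
  \<open>P(X t > y, \<tau> > t)\<close> up to a factor that depends on \<open>t\<close> only.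
\<close>

definition survival_integral :: "real measure \<Rightarrow> real \<Rightarrow> real \<Rightarrow> real \<Rightarrow> real" where
  "survival_integral \<mu> \<alpha> t y = (\<integral>x. exp (\<alpha> * x - x\<^sup>2 / (2 * t)) * tail_kernel \<alpha> t y x \<partial>\<mu>)"

text \<open>
  The common factor of the contributions of starting points \<open>x \<le> \<epsilon> * t\<close>. It does not depend on \<open>y\<close> and
  cancels in the ratio of two survival integrals.
\<close>

definition bulk_mass :: "real measure \<Rightarrow> real \<Rightarrow> real \<Rightarrow> real \<Rightarrow> real" where
  "bulk_mass \<mu> \<alpha> \<epsilon> t = (\<integral>x. x / t * exp (\<alpha> * x - x\<^sup>2 / (2 * t)) * indicator {0..\<epsilon> * t} x \<partial>\<mu>)"

lemma lower_tail_nonneg: "0 \<le> y \<Longrightarrow> 0 \<le> lower_tail \<alpha> y t"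
  unfolding lower_tail_def by (intro Bochner_Integration.integral_nonneg) (auto simp: indicator_def)

context
  fixes \<mu> :: "real measure" and \<alpha> :: real
  assumes \<alpha>: "0 < \<alpha>" and \<mu>: "real_distribution \<mu>" and supp: "measure \<mu> {0..} = 1"
    and pos: "0 < measure \<mu> {0<..}" and rate: "ereal \<alpha> \<le> tail_rate \<mu>"
begin

interpretation real_distribution \<mu> by (rule \<mu>)

lemma AE_nonneg: "AE x in \<mu>. 0 \<le> x"
  using supp by (subst (asm) prob_eq_1) auto

lemma bulk_integrable:
  assumes t: "0 < t" and \<epsilon>: "0 < \<epsilon>"
  shows "integrable \<mu> (\<lambda>x. x / t * exp (\<alpha> * x - x\<^sup>2 / (2 * t)) * indicator {0..\<epsilon> * t} x)"
proof (rule integrable_const_bound[where B = "\<epsilon> * exp (\<alpha> * (\<epsilon> * t))"])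
  show "AE x in \<mu>. norm (x / t * exp (\<alpha> * x - x\<^sup>2 / (2 * t)) * indicator {0..\<epsilon> * t} x) \<le> \<epsilon> * exp (\<alpha> * (\<epsilon> * t))"
  proof (rule AE_I2)
    fix x
    show "norm (x / t * exp (\<alpha> * x - x\<^sup>2 / (2 * t)) * indicator {0..\<epsilon> * t} x) \<le> \<epsilon> * exp (\<alpha> * (\<epsilon> * t))"
    proof (cases "x \<in> {0..\<epsilon> * t}")
      case True
      then have 1: "x / t \<le> \<epsilon>" using t by (simp add: field_simps)
      have "\<alpha> * x \<le> \<alpha> * (\<epsilon> * t)" using True \<alpha> by (intro mult_left_mono) auto
      moreover have "0 \<le> x\<^sup>2 / (2 * t)" using t by simp
      ultimately have "\<alpha> * x - x\<^sup>2 / (2 * t) \<le> \<alpha> * (\<epsilon> * t)" by linarith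
      then have "x / t * exp (\<alpha> * x - x\<^sup>2 / (2 * t)) \<le> \<epsilon> * exp (\<alpha> * (\<epsilon> * t))"
        using 1 \<epsilon> by (intro mult_mono) auto
      then show ?thesis using True t by (simp add: abs_mult)
    qed (use \<epsilon> in simp)
  qed
qed simp

lemma survival_integrable:
  assumes t: "0 < t" and y: "0 \<le> y"
  shows "integrable \<mu> (\<lambda>x. exp (\<alpha> * x - x\<^sup>2 / (2 * t)) * tail_kernel \<alpha> t y x)"
proof -
  define D where "D = (\<integral>z. exp (- (\<alpha> - \<alpha> / 2) * z) * indicator {0<..} z \<partial>lborel)"
  have "integrable \<mu> (\<lambda>x. exp (\<alpha> / 2 * x) * (exp ((\<alpha> / 2)\<^sup>2 * t / 2) * D))"
    using exp_moment_of_tail_rate[OF \<mu> supp rate, of "\<alpha> / 2"] \<alpha> by (intro integrable_mult_left) auto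
  then show ?thesis
  proof (rule Bochner_Integration.integrable_bound)
    show "AE x in \<mu>. norm (exp (\<alpha> * x - x\<^sup>2 / (2 * t)) * tail_kernel \<alpha> t y x)
      \<le> norm (exp (\<alpha> / 2 * x) * (exp ((\<alpha> / 2)\<^sup>2 * t / 2) * D))"
      using AE_nonneg
    proof eventually_elim
      case (elim x)
      have "0 \<le> x / t * lower_tail \<alpha> y t" using elim t lower_tail_nonneg[OF y] by simp
      then have "0 \<le> tail_kernel \<alpha> t y x" using tail_kernel_lower[OF \<alpha> t y elim] by linarith
      then have "norm (exp (\<alpha> * x - x\<^sup>2 / (2 * t)) * tail_kernel \<alpha> t y x)
         = exp (\<alpha> * x - x\<^sup>2 / (2 * t)) * tail_kernel \<alpha> t y x" by simp
      also have "\<dots> \<le> exp ((\<alpha> - \<alpha> / 2) * x + (\<alpha> / 2)\<^sup>2 * t / 2) * D"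
        unfolding D_def by (rule weighted_kernel_bound(1)[OF t y elim]) (use \<alpha> in simp)
      also have "\<dots> = exp (\<alpha> / 2 * x) * (exp ((\<alpha> / 2)\<^sup>2 * t / 2) * D)"
        by (simp add: exp_add)
      finally show ?case by (rule order.trans) simp
    qed
  qed simp
qed

lemma survival_integral_lower:
  assumes t: "0 < t" and y: "0 \<le> y" and \<epsilon>: "0 < \<epsilon>"
  shows "lower_tail \<alpha> y t * bulk_mass \<mu> \<alpha> \<epsilon> t \<le> survival_integral \<mu> \<alpha> t y"
proof -
  have "lower_tail \<alpha> y t * bulk_mass \<mu> \<alpha> \<epsilon> t
     = (\<integral>x. lower_tail \<alpha> y t * (x / t * exp (\<alpha> * x - x\<^sup>2 / (2 * t)) * indicator {0..\<epsilon> * t} x) \<partial>\<mu>)"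
    by (simp add: bulk_mass_def)
  also have "\<dots> \<le> survival_integral \<mu> \<alpha> t y"
    unfolding survival_integral_def
  proof (rule integral_mono_AE)
    show "integrable \<mu> (\<lambda>x. lower_tail \<alpha> y t * (x / t * exp (\<alpha> * x - x\<^sup>2 / (2 * t)) * indicator {0..\<epsilon> * t} x))"
      by (intro integrable_mult_right bulk_integrable t \<epsilon>)
    show "AE x in \<mu>. lower_tail \<alpha> y t * (x / t * exp (\<alpha> * x - x\<^sup>2 / (2 * t)) * indicator {0..\<epsilon> * t} x)
       \<le> exp (\<alpha> * x - x\<^sup>2 / (2 * t)) * tail_kernel \<alpha> t y x"
      using AE_nonneg
    proof eventually_elim
      case (elim x)
      have k: "x / t * lower_tail \<alpha> y t \<le> tail_kernel \<alpha> t y x"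
        by (rule tail_kernel_lower[OF \<alpha> t y elim])
      have "0 \<le> x / t * lower_tail \<alpha> y t" using elim t lower_tail_nonneg[OF y] by simp
      then have "x / t * lower_tail \<alpha> y t * indicator {0..\<epsilon> * t} x \<le> tail_kernel \<alpha> t y x"
        using k by (auto simp: indicator_def)
      from mult_left_mono[OF this, of "exp (\<alpha> * x - x\<^sup>2 / (2 * t))"]
      show ?case by (simp add: mult_ac)
    qed
  qed (rule survival_integrable[OF t y])
  finally show ?thesis .
qed

text \<open>
  Starting points beyond \<open>\<epsilon> * t\<close> are handled by the tilt with \<open>\<theta> = \<epsilon> / 2\<close>: there
  \<open>\<epsilon> * x / 4 \<ge> \<epsilon>\<^sup>2 * t / 4\<close>, so giving up a further \<open>\<epsilon> / 4\<close> of the exponential rate in \<open>x\<close> turns the factor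
  \<open>exp (\<epsilon>\<^sup>2 * t / 8)\<close> into \<open>exp (- \<epsilon>\<^sup>2 * t / 8)\<close> and still leaves an exponent below \<open>\<alpha>\<close>.
\<close>

lemma survival_integral_upper:
  assumes \<epsilon>: "0 < \<epsilon>" "\<epsilon> < \<alpha>"
  obtains C where "0 \<le> C"
    "\<And>t y. 0 < t \<Longrightarrow> 0 \<le> y \<Longrightarrow> survival_integral \<mu> \<alpha> t y
       \<le> gamma_tail (\<alpha> - \<epsilon>) y * bulk_mass \<mu> \<alpha> \<epsilon> t + C * exp (- \<epsilon>\<^sup>2 * t / 8)"
proof
  define D where "D = (\<integral>z. exp (- (\<alpha> - \<epsilon> / 2) * z) * indicator {0<..} z \<partial>lborel)"
  define E where "E = (\<integral>x. exp ((\<alpha> - \<epsilon> / 4) * x) \<partial>\<mu>)"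
  have D0: "0 \<le> D" unfolding D_def by (intro Bochner_Integration.integral_nonneg) auto
  have E0: "0 \<le> E" unfolding E_def by (intro Bochner_Integration.integral_nonneg) auto
  have Ei: "integrable \<mu> (\<lambda>x. exp ((\<alpha> - \<epsilon> / 4) * x))"
    using exp_moment_of_tail_rate[OF \<mu> supp rate, of "\<alpha> - \<epsilon> / 4"] \<epsilon> by simp
  show "0 \<le> D * E" using D0 E0 by simp
  fix t y :: real assume t: "0 < t" and y: "0 \<le> y"
  have i1: "integrable \<mu> (\<lambda>x. gamma_tail (\<alpha> - \<epsilon>) y *
      (x / t * exp (\<alpha> * x - x\<^sup>2 / (2 * t)) * indicator {0..\<epsilon> * t} x))"
    by (intro integrable_mult_right bulk_integrable t \<epsilon>)
  have i2: "integrable \<mu> (\<lambda>x. exp ((\<alpha> - \<epsilon> / 4) * x) * (D * exp (- \<epsilon>\<^sup>2 * t / 8)))"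
    by (intro integrable_mult_left Ei)
  have "survival_integral \<mu> \<alpha> t y
     \<le> (\<integral>x. gamma_tail (\<alpha> - \<epsilon>) y * (x / t * exp (\<alpha> * x - x\<^sup>2 / (2 * t)) * indicator {0..\<epsilon> * t} x)
          + exp ((\<alpha> - \<epsilon> / 4) * x) * (D * exp (- \<epsilon>\<^sup>2 * t / 8)) \<partial>\<mu>)"
    unfolding survival_integral_def
  proof (rule integral_mono_AE[OF survival_integrable[OF t y]])
    show "integrable \<mu> (\<lambda>x. gamma_tail (\<alpha> - \<epsilon>) y * (x / t * exp (\<alpha> * x - x\<^sup>2 / (2 * t)) * indicator {0..\<epsilon> * t} x)
          + exp ((\<alpha> - \<epsilon> / 4) * x) * (D * exp (- \<epsilon>\<^sup>2 * t / 8)))"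
      by (rule Bochner_Integration.integrable_add[OF i1 i2])
    show "AE x in \<mu>. exp (\<alpha> * x - x\<^sup>2 / (2 * t)) * tail_kernel \<alpha> t y x
       \<le> gamma_tail (\<alpha> - \<epsilon>) y * (x / t * exp (\<alpha> * x - x\<^sup>2 / (2 * t)) * indicator {0..\<epsilon> * t} x)
          + exp ((\<alpha> - \<epsilon> / 4) * x) * (D * exp (- \<epsilon>\<^sup>2 * t / 8))"
      using AE_nonneg
    proof eventually_elim
      case (elim x)
      have rest: "0 \<le> exp ((\<alpha> - \<epsilon> / 4) * x) * (D * exp (- \<epsilon>\<^sup>2 * t / 8))" using D0 by simp
      show ?case
      proof (cases "x \<le> \<epsilon> * t")
        case True
        have "exp (\<alpha> * x - x\<^sup>2 / (2 * t)) * tail_kernel \<alpha> t y x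
          \<le> exp (\<alpha> * x - x\<^sup>2 / (2 * t)) * (x / t * gamma_tail (\<alpha> - \<epsilon>) y)"
          using tail_kernel_upper[OF t y elim True \<epsilon>(2)] by (rule mult_left_mono) simp
        also have "\<dots> = gamma_tail (\<alpha> - \<epsilon>) y * (x / t * exp (\<alpha> * x - x\<^sup>2 / (2 * t)) * indicator {0..\<epsilon> * t} x)"
          using True elim by (simp add: mult_ac)
        finally show ?thesis using rest by linarith
      next
        case False
        have "exp (\<alpha> * x - x\<^sup>2 / (2 * t)) * tail_kernel \<alpha> t y x
           \<le> exp ((\<alpha> - \<epsilon> / 2) * x + (\<epsilon> / 2)\<^sup>2 * t / 2) * D"
          unfolding D_def by (rule weighted_kernel_bound(1)[OF t y elim]) (use \<epsilon> in simp)
        also have "\<dots> \<le> exp ((\<alpha> - \<epsilon> / 4) * x + - \<epsilon>\<^sup>2 * t / 8) * D"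
        proof (rule mult_right_mono[OF _ D0])
          have "\<epsilon> * (\<epsilon> * t) \<le> \<epsilon> * x" using False \<epsilon> by (intro mult_left_mono) auto
          then show "exp ((\<alpha> - \<epsilon> / 2) * x + (\<epsilon> / 2)\<^sup>2 * t / 2) \<le> exp ((\<alpha> - \<epsilon> / 4) * x + - \<epsilon>\<^sup>2 * t / 8)"
            by (simp add: power2_eq_square algebra_simps)
        qed
        also have "\<dots> = exp ((\<alpha> - \<epsilon> / 4) * x) * (D * exp (- \<epsilon>\<^sup>2 * t / 8))"
          unfolding exp_add by simp
        finally show ?thesis using False by simp
      qed
    qed
  qed
  also have "\<dots> = gamma_tail (\<alpha> - \<epsilon>) y * bulk_mass \<mu> \<alpha> \<epsilon> t + E * (D * exp (- \<epsilon>\<^sup>2 * t / 8))"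
    unfolding bulk_mass_def E_def
    by (subst Bochner_Integration.integral_add[OF i1 i2]) simp
  finally show "survival_integral \<mu> \<alpha> t y
       \<le> gamma_tail (\<alpha> - \<epsilon>) y * bulk_mass \<mu> \<alpha> \<epsilon> t + D * E * exp (- \<epsilon>\<^sup>2 * t / 8)"
    by (simp add: mult_ac)
qed

text \<open>
  Some compact interval \<open>[1 / r, r]\<close> has positive mass and is contained in \<open>[0, \<epsilon> * t]\<close> for large \<open>t\<close>; on it the
  integrand is at least a constant times \<open>1 / t\<close>.
\<close>

lemma bulk_mass_lower:
  assumes \<epsilon>: "0 < \<epsilon>"
  obtains c where "0 < c" "eventually (\<lambda>t. c / t \<le> bulk_mass \<mu> \<alpha> \<epsilon> t) at_top"
proof -
  have "\<exists>n. measure \<mu> {1 / real (Suc n)..real (Suc n)} \<noteq> 0"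
  proof (rule ccontr)
    assume "\<not> ?thesis"
    then have "emeasure \<mu> {1 / real (Suc n)..real (Suc n)} = 0" for n
      by (simp add: emeasure_eq_measure)
    then have "emeasure \<mu> (\<Union>n. {1 / real (Suc n)..real (Suc n)}) = 0"
      by (intro emeasure_UN_eq_0) auto
    moreover have "range (\<lambda>n. {1 / real (Suc n)..real (Suc n)}) \<subseteq> sets \<mu>" by auto
    moreover have "{0<..} \<subseteq> (\<Union>n. {1 / real (Suc n)..real (Suc n)})"
    proof
      fix x :: real assume x: "x \<in> {0<..}"
      obtain n where n: "max x (1 / x) < real n" using reals_Archimedean2 by blast
      then have "1 / x < real (Suc n)" by simp
      then have "1 / real (Suc n) < x" using x by (simp add: field_simps)
      with n show "x \<in> (\<Union>n. {1 / real (Suc n)..real (Suc n)})" by (auto intro!: exI[of _ n])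
    qed
    ultimately have "emeasure \<mu> {0<..} \<le> 0"
      by (metis (no_types, lifting) emeasure_mono \<open>range (\<lambda>n. {1 / real (Suc n)..real (Suc n)}) \<subseteq> sets \<mu>\<close> sets.countable_UN)
    then show False using pos by (simp add: emeasure_eq_measure ennreal_eq_0_iff)
  qed
  then obtain n where n: "measure \<mu> {1 / real (Suc n)..real (Suc n)} \<noteq> 0" by blast
  define r where "r = real (Suc n)"
  have r: "0 < r" by (simp add: r_def)
  have m: "0 < measure \<mu> {1 / r..r}" using n measure_nonneg[of \<mu> "{1 / r..r}"] unfolding r_def by linarith
  define c where "c = (1 / r) * exp (- r\<^sup>2) * measure \<mu> {1 / r..r}"
  show thesis
  proof
    show "0 < c" using r m by (simp add: c_def)
    show "eventually (\<lambda>t. c / t \<le> bulk_mass \<mu> \<alpha> \<epsilon> t) at_top"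
      using eventually_ge_at_top[of 1] eventually_ge_at_top[of "r / \<epsilon>"]
    proof eventually_elim
      case (elim t)
      then have t: "0 < t" "r \<le> \<epsilon> * t" using \<epsilon> by (auto simp: field_simps)
      have "c / t = (\<integral>x. 1 / r * exp (- r\<^sup>2) / t * indicator {1 / r..r} x \<partial>\<mu>)"
        by (simp add: c_def)
      also have "\<dots> \<le> bulk_mass \<mu> \<alpha> \<epsilon> t"
        unfolding bulk_mass_def
      proof (rule integral_mono'[OF bulk_integrable[OF t(1) \<epsilon>]])
        fix x
        show "0 \<le> x / t * exp (\<alpha> * x - x\<^sup>2 / (2 * t)) * indicator {0..\<epsilon> * t} x"
          using t by (auto simp: indicator_def)
        show "1 / r * exp (- r\<^sup>2) / t * indicator {1 / r..r} x
          \<le> x / t * exp (\<alpha> * x - x\<^sup>2 / (2 * t)) * indicator {0..\<epsilon> * t} x"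
        proof (cases "x \<in> {1 / r..r}")
          case True
          have "0 < 1 / r" using r by simp
          also have "1 / r \<le> x" using True by simp
          finally have x: "0 < x" "x \<le> \<epsilon> * t" using True t by auto
          have "x\<^sup>2 / (2 * t) \<le> x\<^sup>2 / 1" using elim by (intro divide_left_mono) auto
          also have "\<dots> \<le> r\<^sup>2" using x True by (simp add: power_mono)
          finally have "- r\<^sup>2 \<le> \<alpha> * x - x\<^sup>2 / (2 * t)" using mult_pos_pos[OF \<alpha> x(1)] by linarith
          then have "1 / r * exp (- r\<^sup>2) \<le> x * exp (\<alpha> * x - x\<^sup>2 / (2 * t))"
            using True x r by (intro mult_mono) auto
          then have "1 / r * exp (- r\<^sup>2) / t \<le> x * exp (\<alpha> * x - x\<^sup>2 / (2 * t)) / t"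
            using t by (intro divide_right_mono) auto
          then show ?thesis using True x by simp
        qed (use t in \<open>auto simp: indicator_def\<close>)
      qed
      finally show ?case .
    qed
  qed
qed

text \<open>
  For fixed \<open>\<epsilon>\<close> the ratio is squeezed between quantities with limits \<open>gamma_tail \<alpha> y / gamma_tail (\<alpha> - \<epsilon>) 0\<close> and
  \<open>gamma_tail (\<alpha> - \<epsilon>) y / gamma_tail \<alpha> 0\<close>; both approach the same value as \<open>\<epsilon>\<close> tends to \<open>0\<close>.
\<close>

lemma survival_ratio_tendsto:
  assumes y: "0 \<le> y"
  shows "((\<lambda>t. survival_integral \<mu> \<alpha> t y / survival_integral \<mu> \<alpha> t 0)
      \<longlongrightarrow> (1 + \<alpha> * y) * exp (- \<alpha> * y)) at_top"
    and "eventually (\<lambda>t. 0 < survival_integral \<mu> \<alpha> t 0) at_top"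
proof -
  let ?R = "survival_integral \<mu> \<alpha>" and ?g = "gamma_tail"
  have g0: "0 < ?g \<alpha> 0" using \<alpha> by (simp add: gamma_tail_def)
  have sandwich: "\<exists>e. (e \<longlongrightarrow> 0) at_top \<and> eventually (\<lambda>t. 0 < ?R t 0 \<and>
       ?R t y / ?R t 0 \<le> (?g (\<alpha> - \<epsilon>) y + e t) / lower_tail \<alpha> 0 t \<and>
       lower_tail \<alpha> y t / (?g (\<alpha> - \<epsilon>) 0 + e t) \<le> ?R t y / ?R t 0) at_top"
    if \<epsilon>: "0 < \<epsilon>" "\<epsilon> < \<alpha>" for \<epsilon>
  proof -
    obtain C where C: "0 \<le> C" and up: "\<And>t y. 0 < t \<Longrightarrow> 0 \<le> y \<Longrightarrow> ?R t y
       \<le> ?g (\<alpha> - \<epsilon>) y * bulk_mass \<mu> \<alpha> \<epsilon> t + C * exp (- \<epsilon>\<^sup>2 * t / 8)"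
      using survival_integral_upper[OF \<epsilon>] by blast
    obtain c where c: "0 < c" and bulk: "eventually (\<lambda>t. c / t \<le> bulk_mass \<mu> \<alpha> \<epsilon> t) at_top"
      using bulk_mass_lower[OF \<epsilon>(1)] by blast
    \<comment> \<open>Bounds the contribution of \<open>x > \<epsilon> * t\<close> relative to the bulk, which is at least \<open>c / t\<close>.\<close>
    define e where "e t = C / c * (t * exp (- \<epsilon>\<^sup>2 * t / 8))" for t
    have "((\<lambda>t. t * exp (- \<epsilon>\<^sup>2 * t / 8)) \<longlongrightarrow> 0) at_top"
      using \<epsilon> by real_asymp
    then have "(e \<longlongrightarrow> C / c * 0) at_top" unfolding e_def by (intro tendsto_mult tendsto_const)
    moreover have "eventually (\<lambda>t. 0 < lower_tail \<alpha> 0 t) at_top"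
      using order_tendstoD(1)[OF lower_tail_tendsto[OF \<alpha>, of 0] g0] by simp
    then have "eventually (\<lambda>t. 0 < ?R t 0 \<and>
       ?R t y / ?R t 0 \<le> (?g (\<alpha> - \<epsilon>) y + e t) / lower_tail \<alpha> 0 t \<and>
       lower_tail \<alpha> y t / (?g (\<alpha> - \<epsilon>) 0 + e t) \<le> ?R t y / ?R t 0) at_top"
      using bulk eventually_gt_at_top[of 0]
    proof eventually_elim
      case (elim t)
      define A where "A = bulk_mass \<mu> \<alpha> \<epsilon> t"
      have A: "0 < A" using elim(2) divide_pos_pos[OF c elim(3)] unfolding A_def by linarith
      have err: "C * exp (- \<epsilon>\<^sup>2 * t / 8) \<le> e t * A"
      proof -
        have "e t * (c / t) \<le> e t * A"
          using elim C c unfolding A_def e_def by (intro mult_left_mono) auto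
        then show ?thesis using elim c by (simp add: e_def)
      qed
      have u: "?R t v \<le> (?g (\<alpha> - \<epsilon>) v + e t) * A" if "0 \<le> v" for v
        using up[OF elim(3) that] err by (simp add: A_def algebra_simps)
      have l: "lower_tail \<alpha> v t * A \<le> ?R t v" if "0 \<le> v" for v
        using survival_integral_lower[OF elim(3) that \<epsilon>(1)] by (simp add: A_def)
      have pos0: "0 < lower_tail \<alpha> 0 t * A" using elim A by simp
      then have R0: "0 < ?R t 0" using l[of 0] by simp
      have "0 \<le> lower_tail \<alpha> y t * A" using lower_tail_nonneg[OF y] A by simp
      then have Ry: "0 \<le> ?R t y" using l[OF y] by linarith
      have "?R t y / ?R t 0 \<le> ((?g (\<alpha> - \<epsilon>) y + e t) * A) / (lower_tail \<alpha> 0 t * A)"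
        using u[OF y] l[of 0] pos0 Ry by (intro frac_le) auto
      moreover have "(lower_tail \<alpha> y t * A) / ((?g (\<alpha> - \<epsilon>) 0 + e t) * A) \<le> ?R t y / ?R t 0"
        using l[OF y] u[of 0] R0 Ry by (intro frac_le) auto
      ultimately show ?case using R0 A by simp
    qed
    ultimately show ?thesis by auto
  qed
  have "0 < \<alpha> / 2" "\<alpha> / 2 < \<alpha>" using \<alpha> by auto
  from sandwich[OF this] show "eventually (\<lambda>t. 0 < ?R t 0) at_top"
    by (auto elim: eventually_mono)
  have cont: "((\<lambda>\<epsilon>. ?g (\<alpha> - \<epsilon>) v) \<longlongrightarrow> ?g \<alpha> v) (at_right 0)" for v
  proof -
    have "((\<lambda>\<epsilon>. ?g (\<alpha> - \<epsilon>) v) \<longlongrightarrow> ?g (\<alpha> - 0) v) (at_right 0)"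
      unfolding gamma_tail_def using \<alpha> by (intro tendsto_intros) auto
    then show ?thesis by simp
  qed
  have small: "eventually (\<lambda>\<epsilon>::real. 0 < \<epsilon> \<and> \<epsilon> < \<alpha>) (at_right 0)"
    using \<alpha> eventually_at_right_less[of "0::real"] eventually_at_right_field[of "\<lambda>\<epsilon>. \<epsilon> < \<alpha>" 0]
    by (auto intro: eventually_conj)
  have "((\<lambda>t. ?R t y / ?R t 0) \<longlongrightarrow> ?g \<alpha> y / ?g \<alpha> 0) at_top"
  proof (rule order_tendstoI)
    fix b assume b: "?g \<alpha> y / ?g \<alpha> 0 < b"
    have "((\<lambda>\<epsilon>. ?g (\<alpha> - \<epsilon>) y / ?g \<alpha> 0) \<longlongrightarrow> ?g \<alpha> y / ?g \<alpha> 0) (at_right 0)"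
      using g0 by (intro tendsto_divide cont tendsto_const) auto
    from eventually_happens[OF eventually_conj[OF small order_tendstoD(2)[OF this b]]]
    obtain \<epsilon> where \<epsilon>: "0 < \<epsilon>" "\<epsilon> < \<alpha>" "?g (\<alpha> - \<epsilon>) y / ?g \<alpha> 0 < b" by auto
    from sandwich[OF \<epsilon>(1,2)] obtain e where e: "(e \<longlongrightarrow> 0) at_top"
      "eventually (\<lambda>t. ?R t y / ?R t 0 \<le> (?g (\<alpha> - \<epsilon>) y + e t) / lower_tail \<alpha> 0 t) at_top"
      unfolding eventually_conj_iff by blast
    have "((\<lambda>t. (?g (\<alpha> - \<epsilon>) y + e t) / lower_tail \<alpha> 0 t) \<longlongrightarrow> (?g (\<alpha> - \<epsilon>) y + 0) / ?g \<alpha> 0) at_top"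
      using g0 by (intro tendsto_intros e lower_tail_tendsto \<alpha>) auto
    with \<epsilon>(3) have "eventually (\<lambda>t. (?g (\<alpha> - \<epsilon>) y + e t) / lower_tail \<alpha> 0 t < b) at_top"
      by (intro order_tendstoD(2)) auto
    with e(2) show "eventually (\<lambda>t. ?R t y / ?R t 0 < b) at_top"
      by eventually_elim linarith
  next
    fix b assume b: "b < ?g \<alpha> y / ?g \<alpha> 0"
    have "((\<lambda>\<epsilon>. ?g \<alpha> y / ?g (\<alpha> - \<epsilon>) 0) \<longlongrightarrow> ?g \<alpha> y / ?g \<alpha> 0) (at_right 0)"
      using g0 by (intro tendsto_divide cont tendsto_const) auto
    from eventually_happens[OF eventually_conj[OF small order_tendstoD(1)[OF this b]]]
    obtain \<epsilon> where \<epsilon>: "0 < \<epsilon>" "\<epsilon> < \<alpha>" "b < ?g \<alpha> y / ?g (\<alpha> - \<epsilon>) 0" by auto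
    have g0': "0 < ?g (\<alpha> - \<epsilon>) 0" using \<epsilon> by (simp add: gamma_tail_def)
    from sandwich[OF \<epsilon>(1,2)] obtain e where e: "(e \<longlongrightarrow> 0) at_top"
      "eventually (\<lambda>t. lower_tail \<alpha> y t / (?g (\<alpha> - \<epsilon>) 0 + e t) \<le> ?R t y / ?R t 0) at_top"
      unfolding eventually_conj_iff by blast
    have "((\<lambda>t. lower_tail \<alpha> y t / (?g (\<alpha> - \<epsilon>) 0 + e t)) \<longlongrightarrow> ?g \<alpha> y / (?g (\<alpha> - \<epsilon>) 0 + 0)) at_top"
      using g0' by (intro tendsto_intros e lower_tail_tendsto \<alpha> y) auto
    with \<epsilon>(3) have "eventually (\<lambda>t. b < lower_tail \<alpha> y t / (?g (\<alpha> - \<epsilon>) 0 + e t)) at_top"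
      by (intro order_tendstoD(1)) auto
    with e(2) show "eventually (\<lambda>t. b < ?R t y / ?R t 0) at_top"
      by eventually_elim linarith
  qed
  also have "?g \<alpha> y / ?g \<alpha> 0 = (1 + \<alpha> * y) * exp (- \<alpha> * y)"
    using \<alpha> by (simp add: gamma_tail_def)
  finally show "((\<lambda>t. ?R t y / ?R t 0) \<longlongrightarrow> (1 + \<alpha> * y) * exp (- \<alpha> * y)) at_top" .
qed

end

section \<open>Convergence of the conditional laws\<close>

lemma limit_law_tail:
  assumes a: "0 < \<alpha>" and y: "0 \<le> y"
  shows "emeasure (limit_law \<alpha>) {y<..} = ennreal ((1 + \<alpha> * y) * exp (- \<alpha> * y))"
proof -
  have "emeasure (limit_law \<alpha>) {y<..}
     = (\<integral>\<^sup>+z. ennreal (\<alpha>\<^sup>2 * z * exp (- \<alpha> * z)) * indicator {0<..} z * indicator {y<..} z \<partial>lborel)"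
    unfolding limit_law_def by (subst emeasure_density) auto
  also have "\<dots> = (\<integral>\<^sup>+z. ennreal (\<alpha>\<^sup>2) * ennreal (z * exp (- \<alpha> * z) * indicator {y<..} z) \<partial>lborel)"
    using y by (intro nn_integral_cong) (auto simp: indicator_def ennreal_mult'[symmetric] mult_ac)
  also have "\<dots> = ennreal (\<alpha>\<^sup>2) * ennreal (gamma_tail \<alpha> y)"
    by (subst nn_integral_cmult, measurable, simp only: gamma_tail_nn[OF a y])
  also have "\<dots> = ennreal ((1 + \<alpha> * y) * exp (- \<alpha> * y))"
    using a by (simp add: ennreal_mult'[symmetric] gamma_tail_def)
  finally show ?thesis .
qed

lemma limit_law_nonpos: "emeasure (limit_law \<alpha>) {..0} = 0"
  unfolding limit_law_def by (subst emeasure_density) (auto intro!: nn_integral_zero' AE_I2 simp: indicator_def)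

lemma cdf_limit_law:
  assumes a: "0 < \<alpha>"
  shows "cdf (limit_law \<alpha>) y = (if y < 0 then 0 else 1 - (1 + \<alpha> * y) * exp (- \<alpha> * y))"
proof -
  have sets: "sets (limit_law \<alpha>) = sets borel" by (simp add: limit_law_def)
  have space: "space (limit_law \<alpha>) = UNIV" by (simp add: limit_law_def)
  have neg: "measure (limit_law \<alpha>) {..0} = 0"
    using limit_law_nonpos[of \<alpha>] by (simp add: measure_def)
  have tail: "measure (limit_law \<alpha>) {v<..} = (1 + \<alpha> * v) * exp (- \<alpha> * v)" if "0 \<le> v" for v
    using limit_law_tail[OF a that] a that by (simp add: measure_def)
  have "emeasure (limit_law \<alpha>) UNIV = emeasure (limit_law \<alpha>) {..0} + emeasure (limit_law \<alpha>) {0<..}"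
    by (subst plus_emeasure) (auto simp: sets ivl_disj_un intro!: arg_cong[where f = "emeasure _"])
  then have "emeasure (limit_law \<alpha>) UNIV = 1"
    using limit_law_tail[OF a, of 0] by (simp add: limit_law_nonpos)
  then interpret prob_space "limit_law \<alpha>" by (intro prob_spaceI) (simp add: space)
  show ?thesis
  proof (cases "y < 0")
    case True
    then have "measure (limit_law \<alpha>) {..y} \<le> measure (limit_law \<alpha>) {..0}"
      by (intro finite_measure_mono) (auto simp: sets)
    then show ?thesis using True neg measure_nonneg[of "limit_law \<alpha>" "{..y}"] by (simp add: cdf_def)
  next
    case False
    have "measure (limit_law \<alpha>) (space (limit_law \<alpha>) - {y<..}) = 1 - measure (limit_law \<alpha>) {y<..}"
      by (rule prob_compl) (simp add: sets)
    moreover have "space (limit_law \<alpha>) - {y<..} = {..y}" by (auto simp: space)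
    ultimately show ?thesis using False tail[of y] by (simp add: cdf_def)
  qed
qed

context absorbed_drifted_brownian_motion
begin

text \<open>
  The process is positive on the event of survival, so the survival probability itself is the tail at \<open>y = 0\<close>.
\<close>

lemma cdf_conditional_law:
  assumes a: "0 \<le> \<alpha>" and t: "0 < t" and pos: "0 < survival_integral (distr M borel (X 0)) \<alpha> t 0"
  shows "cdf (conditional_law M X t) y = (if y < 0 then 0 else
    1 - survival_integral (distr M borel (X 0)) \<alpha> t y / survival_integral (distr M borel (X 0)) \<alpha> t 0)"
proof -
  define S where "S = survival_event M X t"
  define K where "K = 2 * (exp (- \<alpha>\<^sup>2 * t / 2) / sqrt (2 * pi * t))"
  let ?R = "survival_integral (distr M borel (X 0)) \<alpha> t"
  have K: "0 < K" using t by (simp add: K_def)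
  have [measurable]: "S \<in> sets M" "X t \<in> borel_measurable M"
    unfolding S_def using survival_event_measurable[OF t] X_measurable[OF t] by auto
  have SX: "0 < X t \<omega>" if "\<omega> \<in> S" for \<omega>
    using that t X_eq[of \<omega> t] survival_event_eq[of t] unfolding S_def by auto
  have tail: "prob {\<omega> \<in> S. v < X t \<omega>} = K * ?R v" if "0 \<le> v" for v
    unfolding S_def K_def survival_integral_def using survival_tail[OF a t that] .
  have S0: "prob S = K * ?R 0"
  proof -
    have "S = {\<omega> \<in> S. 0 < X t \<omega>}" using SX by blast
    then show ?thesis using tail[of 0] by simp
  qed
  then have Spos: "0 < prob S" using K pos by simp
  have "cdf (conditional_law M X t) y = measure (uniform_measure M S) (X t -` {..y} \<inter> space M)"
    unfolding cdf_def conditional_law_def S_def[symmetric] by (subst measure_distr) auto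
  also have "\<dots> = prob (S \<inter> (X t -` {..y} \<inter> space M)) / prob S"
    using Spos by (subst measure_uniform_measure) (auto simp: emeasure_eq_measure)
  finally have c: "cdf (conditional_law M X t) y = prob (S \<inter> (X t -` {..y} \<inter> space M)) / prob S" .
  show ?thesis
  proof (cases "y < 0")
    case True
    have "X t \<omega> \<notin> {..y}" if "\<omega> \<in> S" for \<omega> using SX[OF that] True by auto
    then have "S \<inter> (X t -` {..y} \<inter> space M) = {}" by blast
    then show ?thesis using c True by simp
  next
    case False
    have sub: "S \<subseteq> space M" by (auto simp: S_def survival_event_def)
    then have "S \<inter> (X t -` {..y} \<inter> space M) = S - {\<omega> \<in> S. y < X t \<omega>}" by auto
    then have "prob (S \<inter> (X t -` {..y} \<inter> space M)) = prob S - prob {\<omega> \<in> S. y < X t \<omega>}"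
      by (simp only:) (rule finite_measure_Diff, auto)
    then show ?thesis
      using c False tail[of y] S0 K pos by (simp add: diff_divide_distrib)
  qed
qed

end

theorem theorem3:
  fixes M :: "'a measure" and B X :: "real \<Rightarrow> 'a \<Rightarrow> real"
    and \<alpha> :: real and \<mu> :: "real measure"
  assumes "\<alpha> > 0"
    and "real_distribution \<mu>"
    and "measure \<mu> {0..} = 1"
    and "measure \<mu> {0<..} > 0"
    and "tail_rate \<mu> \<ge> ereal \<alpha>"
    and "absorbed_drifted_brownian_motion M B \<alpha> X"
    and "distr M borel (X 0) = \<mu>"
  shows "weak_conv_filter (conditional_law M X) (limit_law \<alpha>) at_top"
  unfolding weak_conv_filter_def
proof (intro allI impI)
  fix y :: real
  interpret absorbed_drifted_brownian_motion M B \<alpha> X by fact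
  note ratio = survival_ratio_tendsto[OF assms(1-5)]
  have ev: "eventually (\<lambda>t. cdf (conditional_law M X t) y = (if y < 0 then 0 else
      1 - survival_integral \<mu> \<alpha> t y / survival_integral \<mu> \<alpha> t 0)) at_top"
    using ratio(2)[OF order_refl] eventually_gt_at_top[of 0]
  proof eventually_elim
    case (elim t)
    then show ?case using cdf_conditional_law[of t y] assms(1,7) by simp
  qed
  have "((\<lambda>t. if y < 0 then 0 else 1 - survival_integral \<mu> \<alpha> t y / survival_integral \<mu> \<alpha> t 0)
      \<longlongrightarrow> cdf (limit_law \<alpha>) y) at_top"
  proof (cases "y < 0")
    case False
    then show ?thesis
      unfolding cdf_limit_law[OF assms(1)] using tendsto_diff[OF tendsto_const[of 1] ratio(1)[of y]] by simp
  qed (simp add: cdf_limit_law[OF assms(1)])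
  then show "((\<lambda>t. cdf (conditional_law M X t) y) \<longlongrightarrow> cdf (limit_law \<alpha>) y) at_top"
    by (rule Lim_transform_eventually) (use ev in eventually_elim, simp)
qed

end
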